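(* Let $G$ be a 3-connected graph with lattice of integer flows ${\mathcal F}(G)$ and Voronoi cell $V(G)$. Then: (1) The map sending $e\in E(G)$ to the set of edges of $V(G)$ of the form $\Phi^{-1}(G-e,\omega)$, with $\omega$ ranging over strong orientations of $G-e$, is a bijection between $E(G)$ and the parallel classes of edges (one-dimensional faces) of $V(G)$. (2) The map sending an (unoriented) circuit $C$ of $G$ to $\{F_C,F_{-C}\}$ is a bijection between the circuits of $G$ and the parallel classes of codimension one faces of $V(G)$. (3) An edge $e\in E(G)$ belongs to a circuit $C$ (i.e. $C\not\subset G-e$) if and only if no member of the parallel class of edges of $V(G)$ corresponding to $e$ is contained in the face $F_C$. Consequently, in that case no member of that class is contained in $F_{-C}$ either.
   Context: Graphs are finite and connected, with loops and multiple edges allowed. A subgraph means a spanning subgraph determined by a subset of edges; $G-e$ denotes deleting the edge $e$. $G$ is 3-connected if it remains connected after deleting any two edges (3-edge-connected). A circuit is a closed walk repeating no vertex or edge. An oriented circuit is a circuit with a cyclic orientation; $-C$ denotes the reverse orientation. Fix a reference orientation of $G$. The lattice of integer flows ${\mathcal F}(G)\subset\mathbb Z^{E(G)}$ is the set of $\sum_e a_e e$ with, at each vertex, the sum over incoming edges equal to the sum over outgoing edges. It has the inner product restricted from the standard one. An oriented circuit $C$ gives a circuit element $C\in{\mathcal F}(G)$ with coefficients $\pm1$ on its edges (according to agreement with the reference orientation) and $0$ elsewhere. The Voronoi cell is $V(G)=\{x\in{\mathcal F}(G)\otimes\mathbb R:(x,x)\le(x-v,x-v)\ \forall v\in{\mathcal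 F}(G)\}$. Its codimension one faces are exactly $F_C=V(G)\cap\{x:(x,C)=(C,C)/2\}$ for oriented circuits $C$, and $F_{-C}=-F_C$. Edges of $V(G)$ are its one-dimensional faces. Faces are parallel if their affine hulls are translates of each other. A strong orientation of a subgraph is one making each connected component strongly connected. $\mathcal S(G)$ is the poset of pairs $(H,\omega_H)$ with $H$ a subgraph and $\omega_H$ a strong orientation. The order is $(H,\omega_H)\preceq(H',\omega')$ iff $H'\subseteq H$ and $\omega'$ is the restriction of $\omega_H$. Amini's theorem (cited) gives a poset isomorphism $\Phi$ from faces of $V(G)$ under inclusion to $\mathcal S(G)$. Under $\Phi$, codimension equals the genus (rank of the flow lattice) of the subgraph, and $F_C$ corresponds to $C$ with its cyclic orientation. *)

theory Defs
  imports "HOL-Analysis.Analysis" "Graph_Theory.Digraph_Component"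
begin

text \<open>
  A finite graph with loops and multiple edges, together with a reference orientation, is a
  \<^locale>\<open>fin_digraph\<close> \<open>G\<close>: the edges are \<open>arcs G\<close>, and tail and head give the reference
  orientation. The edges live in a finite type \<open>'e\<close>, and \<open>\<int>\<^sup>E\<close> and \<open>\<real>\<^sup>E\<close> are
  the vectors of \<^typ>\<open>real^'e\<close> vanishing outside \<open>arcs G\<close>; in this way \<open>arcs G = {}\<close> is allowed.
\<close>

definition spanning_sub :: "('v, 'e) pre_digraph \<Rightarrow> 'e set \<Rightarrow> ('v, 'e) pre_digraph" where
  "spanning_sub G H = G\<lparr>arcs := H\<rparr>"

text \<open>
  Deleting at most two edges rather than exactly two, so that a graph with a bridge is never
  3-connected, even if it has only one edge. \<^const>\<open>Digraph_Component.connected\<close>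
  is connectedness of the underlying undirected graph.
\<close>

definition three_connected :: "('v, 'e) pre_digraph \<Rightarrow> bool" where
  "three_connected G \<longleftrightarrow>
     (\<forall>X \<subseteq> arcs G. card X \<le> 2 \<longrightarrow>
        Digraph_Component.connected (spanning_sub G (arcs G - X)))"

text \<open>
  An oriented subgraph is a pair \<open>(H, \<omega>)\<close> of an edge set and a sign function: \<open>\<omega> e = 1\<close> if \<open>e\<close>
  is oriented as in the reference orientation, \<open>\<omega> e = -1\<close> if it is oriented oppositely. The value
  outside \<open>H\<close> is normalised to \<open>0\<close>, so that equality of pairs is equality of oriented subgraphs.
  With signs, a loop has two orientations, like any other edge.
\<close>

type_synonym 'e oriented_subgraph = "'e set \<times> ('e \<Rightarrow> int)"

definition is_oriented_subgraph :: "('v, 'e) pre_digraph \<Rightarrow> 'e oriented_subgraph \<Rightarrow> bool" where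
  "is_oriented_subgraph G = (\<lambda>(H, \<omega>).
     H \<subseteq> arcs G \<and> (\<forall>e\<in>H. \<omega> e \<in> {1, -1}) \<and> (\<forall>e. e \<notin> H \<longrightarrow> \<omega> e = 0))"

definition oriented_digraph ::
  "('v, 'e) pre_digraph \<Rightarrow> 'e oriented_subgraph \<Rightarrow> ('v, 'e) pre_digraph" where
  "oriented_digraph G = (\<lambda>(H, \<omega>).
     \<lparr>verts = verts G, arcs = H,
      tail = (\<lambda>e. if \<omega> e = 1 then tail G e else head G e),
      head = (\<lambda>e. if \<omega> e = 1 then head G e else tail G e)\<rparr>)"

definition opposite :: "'e oriented_subgraph \<Rightarrow> 'e oriented_subgraph" where
  "opposite = (\<lambda>(H, \<omega>). (H, \<lambda>e. - \<omega> e))"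

text \<open>The strongly connected components of the symmetrisation are the connected components.\<close>

definition connected_components :: "('v, 'e) pre_digraph \<Rightarrow> 'v set set" where
  "connected_components D = pre_digraph.sccs_verts (with_proj (mk_symmetric D))"

definition strongly_oriented_subgraphs ::
  "('v, 'e) pre_digraph \<Rightarrow> 'e oriented_subgraph set" where
  "strongly_oriented_subgraphs G =
     {A. is_oriented_subgraph G A \<and>
         (\<forall>K \<in> connected_components (oriented_digraph G A).
            strongly_connected (oriented_digraph G A \<restriction> K))}"

definition oriented_subgraph_le ::
  "'e oriented_subgraph \<Rightarrow> 'e oriented_subgraph \<Rightarrow> bool" where
  "oriented_subgraph_le = (\<lambda>(H, \<omega>) (H', \<omega>'). H' \<subseteq> H \<and> (\<forall>e\<in>H'. \<omega>' e = \<omega> e))"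

text \<open>
  Since every edge of \<open>H\<close> has exactly one direction in the oriented digraph, a closed directed walk
  without repeated vertices traverses no edge twice, in particular not back and forth.
\<close>

definition oriented_circuits :: "('v, 'e) pre_digraph \<Rightarrow> 'e oriented_subgraph set" where
  "oriented_circuits G =
     {C. is_oriented_subgraph G C \<and>
         (\<exists>p. pre_digraph.cycle (oriented_digraph G C) p \<and> set p = fst C)}"

definition circuits :: "('v, 'e) pre_digraph \<Rightarrow> 'e set set" where
  "circuits G = fst ` oriented_circuits G"

definition flow_lattice :: "('v, 'e::finite) pre_digraph \<Rightarrow> (real^'e) set" where
  "flow_lattice G =
     {a. (\<forall>e. a $ e \<in> \<int>) \<and> (\<forall>e. e \<notin> arcs G \<longrightarrow> a $ e = 0) \<and>
         (\<forall>v\<in>verts G. (\<Sum>e\<in>in_arcs G v. a $ e) = (\<Sum>e\<in>out_arcs G v. a $ e))}"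

text \<open>The rank of a sublattice of \<open>\<int>\<^sup>E\<close> is the dimension of its real span.\<close>

definition genus :: "('v, 'e::finite) pre_digraph \<Rightarrow> nat" where
  "genus G = dim (flow_lattice G)"

definition circuit_element :: "'e::finite oriented_subgraph \<Rightarrow> real^'e" where
  "circuit_element C = (\<chi> e. of_int (snd C e))"

text \<open>The real vector space \<open>F(G) \<otimes> \<real>\<close> is realised as the span of the lattice.\<close>

definition voronoi_cell :: "('v, 'e::finite) pre_digraph \<Rightarrow> (real^'e) set" where
  "voronoi_cell G =
     {x \<in> span (flow_lattice G). \<forall>v \<in> flow_lattice G. x \<bullet> x \<le> (x - v) \<bullet> (x - v)}"

definition circuit_face ::
  "('v, 'e::finite) pre_digraph \<Rightarrow> 'e oriented_subgraph \<Rightarrow> (real^'e) set" where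
  "circuit_face G C =
     voronoi_cell G \<inter>
       {x. x \<bullet> circuit_element C = (circuit_element C \<bullet> circuit_element C) / 2}"

text \<open>Faces are nonempty; the whole cell is a face.\<close>

definition voronoi_faces :: "('v, 'e::finite) pre_digraph \<Rightarrow> (real^'e) set set" where
  "voronoi_faces G = {F. F face_of voronoi_cell G \<and> F \<noteq> {}}"

definition amini_isomorphism ::
  "('v, 'e::finite) pre_digraph \<Rightarrow> ((real^'e) set \<Rightarrow> 'e oriented_subgraph) \<Rightarrow> bool" where
  "amini_isomorphism G \<phi> \<longleftrightarrow>
     bij_betw \<phi> (voronoi_faces G) (strongly_oriented_subgraphs G) \<and>
     (\<forall>F\<in>voronoi_faces G. \<forall>F'\<in>voronoi_faces G.
        F \<subseteq> F' \<longleftrightarrow> oriented_subgraph_le (\<phi> F) (\<phi> F')) \<and>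
     (\<forall>F\<in>voronoi_faces G.
        aff_dim (voronoi_cell G) - aff_dim F = int (genus (spanning_sub G (fst (\<phi> F))))) \<and>
     (\<forall>C\<in>oriented_circuits G.
        circuit_face G C \<in> voronoi_faces G \<and> \<phi> (circuit_face G C) = C)"

text \<open>
  Amini's theorem says that such an isomorphism exists. It is unique on the faces of the cell:
  a strongly oriented subgraph is the union of the oriented circuits it contains, and for
  \<open>\<phi> F\<close> these are the \<open>C\<close> with \<open>F \<subseteq> circuit_face G C\<close>.
\<close>

definition Amini :: "('v, 'e::finite) pre_digraph \<Rightarrow> (real^'e) set \<Rightarrow> 'e oriented_subgraph" where
  "Amini G = (SOME \<phi>. amini_isomorphism G \<phi>)"

definition Amini_inv :: "('v, 'e::finite) pre_digraph \<Rightarrow> 'e oriented_subgraph \<Rightarrow> (real^'e) set" where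
  "Amini_inv G = inv_into (voronoi_faces G) (Amini G)"

definition voronoi_edges :: "('v, 'e::finite) pre_digraph \<Rightarrow> (real^'e) set set" where
  "voronoi_edges G = {F. F edge_of voronoi_cell G}"

definition voronoi_facets :: "('v, 'e::finite) pre_digraph \<Rightarrow> (real^'e) set set" where
  "voronoi_facets G = {F. F facet_of voronoi_cell G}"

definition parallel_classes :: "'a::real_vector set set \<Rightarrow> 'a set set set" where
  "parallel_classes \<F> =
     \<F> // {(F, F'). F \<in> \<F> \<and> F' \<in> \<F> \<and> affine_parallel (affine hull F) (affine hull F')}"

definition edge_class :: "('v, 'e::finite) pre_digraph \<Rightarrow> 'e \<Rightarrow> (real^'e) set set" where
  "edge_class G e =
     {Amini_inv G (arcs G - {e}, \<omega>) | \<omega>.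
        (arcs G - {e}, \<omega>) \<in> strongly_oriented_subgraphs G}"

text \<open>
  The pair of the faces of \<open>C\<close> and \<open>-C\<close>, for \<open>C\<close> either of the two cyclic orientations of the
  circuit; the union only serves to avoid choosing one of them.
\<close>

definition circuit_class :: "('v, 'e::finite) pre_digraph \<Rightarrow> 'e set \<Rightarrow> (real^'e) set set" where
  "circuit_class G H =
     (\<Union>C \<in> {C \<in> oriented_circuits G. fst C = H}.
        {circuit_face G C, circuit_face G (opposite C)})"

end

theory Submission
  imports Defs
begin

text \<open>
  Let \<open>W\<close> be the real flow space. Every flow is a sum of positive multiples of circuit elements
  agreeing with it in sign, and a circuit element has the same squared norm and \<open>l\<^sub>1\<close>-norm; hence
  the Voronoi cell is \<open>{x \<in> W. 2 (x, w) \<le> \<parallel>w\<parallel>\<^sub>1 for all w \<in> W}\<close>, which is the orthogonal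
  projection to \<open>W\<close> of the cube of side 1 around the origin. The face on which \<open>w \<in> W\<close> is maximal
  is the projection of a face of the cube given by the signs of \<open>w\<close>, so the faces are in bijection
  with the sign patterns of flows. These are the strongly oriented subgraphs, which gives Amini's
  theorem. The linear functionals constant on the face of \<open>w\<close> are the flows supported in the
  support of \<open>w\<close>: this yields the dimension of the face, and two faces are parallel iff their
  supports agree. By 3-connectedness no two coordinates are proportional on \<open>W\<close>, so
  the supports of codimension one in \<open>W\<close> are the sets \<open>E - e\<close>; each of them carries a
  nowhere vanishing flow, because no coordinate other than \<open>e\<close> vanishes identically on the flows
  that avoid \<open>e\<close>.
\<close>

section \<open>Projections of the cube\<close>

definition supp :: "real^'e \<Rightarrow> 'e set" where
  "supp w = {e. w $ e \<noteq> 0}"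

text \<open>The order on sign vectors: zeroing coordinates in the sign vector of \<open>w\<close>
  yields that of \<open>u\<close>. On faces it becomes reverse inclusion.\<close>

definition conformal :: "real^'e \<Rightarrow> real^'e \<Rightarrow> bool" where
  "conformal u w \<longleftrightarrow> (\<forall>e. u $ e \<noteq> 0 \<longrightarrow> sgn (u $ e) = sgn (w $ e))"

definition l1norm :: "real^'e::finite \<Rightarrow> real" where
  "l1norm w = (\<Sum>e\<in>UNIV. \<bar>w $ e\<bar>)"

text \<open>
  Twice the support function of \<open>half_cube\<close> is \<^const>\<open>l1norm\<close>, so this is the polar description
  of the orthogonal projection of that cube to \<open>W\<close>.
\<close>

definition zonotope :: "(real^'e::finite) set \<Rightarrow> (real^'e) set" where
  "zonotope W = {x \<in> W. \<forall>w\<in>W. 2 * (x \<bullet> w) \<le> l1norm w}"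

definition zono_face :: "(real^'e::finite) set \<Rightarrow> real^'e \<Rightarrow> (real^'e) set" where
  "zono_face W w = {x \<in> zonotope W. 2 * (x \<bullet> w) = l1norm w}"

definition half_cube :: "(real^'e) set" where
  "half_cube = {y. \<forall>e. \<bar>y $ e\<bar> \<le> 1/2}"

text \<open>The face of the cube exposed by the functional \<open>w\<close>.\<close>

definition cube_face :: "real^'e \<Rightarrow> (real^'e) set" where
  "cube_face w = {y \<in> half_cube. \<forall>e. w $ e \<noteq> 0 \<longrightarrow> y $ e = sgn (w $ e) / 2}"

definition orth_proj :: "'a::euclidean_space set \<Rightarrow> 'a \<Rightarrow> 'a" where
  "orth_proj W x = (SOME y. y \<in> W \<and> (\<forall>w\<in>W. y \<bullet> w = x \<bullet> w))"

definition restrict_support :: "(real^'e) set \<Rightarrow> 'e set \<Rightarrow> (real^'e) set" where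
  "restrict_support W H = {u \<in> W. \<forall>e. e \<notin> H \<longrightarrow> u $ e = 0}"

section \<open>Orthogonal projection onto a subspace\<close>

lemma orth_proj:
  assumes "subspace W"
  shows orth_proj_in: "orth_proj W x \<in> W"
    and orth_proj_inner: "w \<in> W \<Longrightarrow> orth_proj W x \<bullet> w = x \<bullet> w"
proof -
  have [simp]: "span W = W" using assms by simp
  obtain y z where "y \<in> span W" "\<And>w. w \<in> span W \<Longrightarrow> orthogonal z w" "x = y + z"
    using orthogonal_subspace_decomp_exists[of W x] by metis
  then have "y \<in> W \<and> (\<forall>w\<in>W. y \<bullet> w = x \<bullet> w)"
    by (auto simp: inner_add_left orthogonal_def)
  then have "orth_proj W x \<in> W \<and> (\<forall>w\<in>W. orth_proj W x \<bullet> w = x \<bullet> w)"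
    unfolding orth_proj_def by (rule someI)
  then show "orth_proj W x \<in> W" "w \<in> W \<Longrightarrow> orth_proj W x \<bullet> w = x \<bullet> w"
    by auto
qed

lemma subspace_eqI_inner:
  fixes x :: "'a::euclidean_space"
  assumes "subspace W" "x \<in> W" "y \<in> W" "\<And>w. w \<in> W \<Longrightarrow> x \<bullet> w = y \<bullet> w"
  shows "x = y"
proof -
  have "(x - y) \<bullet> (x - y) = 0"
    using assms by (simp add: inner_diff_left subspace_diff)
  then show ?thesis by simp
qed

lemma orth_proj_eqI:
  fixes x :: "'a::euclidean_space"
  assumes "subspace W" "y \<in> W" "\<And>w. w \<in> W \<Longrightarrow> y \<bullet> w = x \<bullet> w"
  shows "orth_proj W x = y"
  using assms by (intro subspace_eqI_inner[of W]) (auto simp: orth_proj)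

lemma linear_orth_proj:
  fixes W :: "'a::euclidean_space set"
  assumes "subspace W" shows "linear (orth_proj W)"
proof (rule linearI)
  fix x y :: 'a and c :: real
  show "orth_proj W (x + y) = orth_proj W x + orth_proj W y"
    using assms by (intro orth_proj_eqI) (auto simp: orth_proj inner_add_left subspace_add)
  show "orth_proj W (c *\<^sub>R x) = c *\<^sub>R orth_proj W x"
    using assms by (intro orth_proj_eqI) (auto simp: orth_proj subspace_scale)
qed

section \<open>The cube and its projection\<close>

lemma half_cube_eq_cbox: "half_cube = cbox (\<chi> e. - 1/2) ((\<chi> e. 1/2) :: real^'e::finite)"
proof -
  have "\<bar>a\<bar> \<le> 1/2 \<longleftrightarrow> - 1/2 \<le> a \<and> a \<le> 1/2" for a :: real by linarith
  then show ?thesis unfolding half_cube_def set_eq_iff mem_box_cart by simp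
qed

lemma cube_face_subset: "cube_face w \<subseteq> half_cube"
  by (auto simp: cube_face_def)

text \<open>The centre of the face: since \<open>sgn 0 = 0\<close>, its free coordinates are
  \<open>0\<close>. It serves as the test point below.\<close>

lemma half_sgn_in_cube_face: "(\<chi> e. sgn (w $ e) / 2) \<in> cube_face w"
  by (auto simp: cube_face_def half_cube_def sgn_if)

lemma half_cube_inner_le:
  assumes "y \<in> half_cube" shows "2 * (y \<bullet> w) \<le> l1norm w"
proof -
  have "y $ e * w $ e \<le> \<bar>w $ e\<bar> / 2" for e
  proof -
    have "y $ e * w $ e \<le> \<bar>y $ e\<bar> * \<bar>w $ e\<bar>" by (metis abs_ge_self abs_mult)
    also have "\<dots> \<le> (1/2) * \<bar>w $ e\<bar>"
      using assms by (intro mult_right_mono) (auto simp: half_cube_def)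
    finally show ?thesis by simp
  qed
  then have "2 * (y $ e * w $ e) \<le> \<bar>w $ e\<bar>" for e by (simp add: mult.commute)
  then show ?thesis
    unfolding inner_vec_def l1norm_def sum_distrib_left inner_real_def by (intro sum_mono) auto
qed

text \<open>Each term of the inner product is at most \<open>\<bar>w $ e\<bar> / 2\<close>, so
  equality of the sums forces equality in every coordinate.\<close>

lemma half_cube_inner_eq_iff:
  assumes y: "y \<in> half_cube"
  shows "2 * (y \<bullet> w) = l1norm w \<longleftrightarrow> y \<in> cube_face w"
proof -
  have le: "y $ e * w $ e \<le> \<bar>w $ e\<bar> / 2" for e
  proof -
    have "y $ e * w $ e \<le> \<bar>y $ e\<bar> * \<bar>w $ e\<bar>" by (metis abs_ge_self abs_mult)
    also have "\<dots> \<le> (1/2) * \<bar>w $ e\<bar>"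
      using assms by (intro mult_right_mono) (auto simp: half_cube_def)
    finally show ?thesis by simp
  qed
  have "2 * (y \<bullet> w) = l1norm w \<longleftrightarrow> (\<Sum>e\<in>UNIV. \<bar>w $ e\<bar> / 2 - y $ e * w $ e) = 0"
    by (auto simp: inner_vec_def l1norm_def sum_subtractf sum_divide_distrib[symmetric])
  also have "\<dots> \<longleftrightarrow> (\<forall>e. \<bar>w $ e\<bar> / 2 - y $ e * w $ e = 0)"
    using le by (subst sum_nonneg_eq_0_iff) auto
  also have "\<dots> \<longleftrightarrow> (\<forall>e. w $ e \<noteq> 0 \<longrightarrow> y $ e = sgn (w $ e) / 2)"
  proof (intro all_cong1)
    fix e
    have "w $ e * 2 * y $ e = w $ e * sgn (w $ e) \<longleftrightarrow> w $ e = 0 \<or> 2 * y $ e = sgn (w $ e)"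
      by auto
    then show "\<bar>w $ e\<bar> / 2 - y $ e * w $ e = 0 \<longleftrightarrow> (w $ e \<noteq> 0 \<longrightarrow> y $ e = sgn (w $ e) / 2)"
      by (auto simp: abs_sgn field_simps)
  qed
  finally show ?thesis using y by (auto simp: cube_face_def)
qed

lemma orth_proj_half_cube_subset:
  assumes "subspace W" shows "orth_proj W ` half_cube \<subseteq> zonotope W"
  using assms by (auto simp: zonotope_def orth_proj half_cube_inner_le)

text \<open>A point of the polar description outside the compact convex projection could be
  separated from it. The separating functional can be taken in \<open>W\<close>; on the cube it
  reaches half its \<open>l1norm\<close>, which bounds it at the point as well.\<close>

lemma zonotope_eq:
  fixes W :: "(real^'e::finite) set"
  assumes W: "subspace W" shows "zonotope W = orth_proj W ` half_cube"
proof (rule antisym[OF _ orth_proj_half_cube_subset[OF W]], rule subsetI, rule ccontr)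
  fix x assume x: "x \<in> zonotope W" and nx: "x \<notin> orth_proj W ` half_cube"
  have lin: "linear (orth_proj W)" using W by (rule linear_orth_proj)
  let ?Z = "orth_proj W ` half_cube"
  have "convex ?Z" by (auto intro!: convex_linear_image lin simp: half_cube_eq_cbox)
  moreover have "compact ?Z" unfolding half_cube_eq_cbox
    by (intro compact_continuous_image linear_continuous_on linear_conv_bounded_linear[THEN iffD1] lin)
       simp
  then have "closed ?Z" by (rule compact_imp_closed)
  ultimately obtain a b where ab: "a \<bullet> x < b" "\<And>z. z \<in> ?Z \<Longrightarrow> b < a \<bullet> z"
    using separating_hyperplane_closed_point[of ?Z x] nx by auto
  \<comment> \<open>On \<open>W\<close> the functional \<open>a\<close> acts as the negative of
    \<open>?w\<close>; the sign change makes \<open>x\<close> the point where \<open>?w\<close> is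
    large.\<close>
  let ?w = "orth_proj W (- a)"
  have "?w \<in> W" using W by (rule orth_proj_in)
  have xW: "x \<in> W" using x by (simp add: zonotope_def)
  have neg: "a \<bullet> z = - (z \<bullet> ?w)" if "z \<in> W" for z
    using orth_proj_inner[OF W that, of "- a"] by (simp add: inner_commute)
  \<comment> \<open>A maximiser of \<open>?w\<close> on the cube.\<close>
  let ?y = "(\<chi> e. sgn (?w $ e) / 2) :: real^'e"
  have y: "?y \<in> half_cube" "?y \<in> cube_face ?w"
    using half_sgn_in_cube_face[of ?w] cube_face_subset[of ?w] by auto
  have "b < a \<bullet> orth_proj W ?y" using ab(2) y by auto
  also have "\<dots> = - (orth_proj W ?y \<bullet> ?w)"
    using neg[of "orth_proj W ?y"] W by (simp add: orth_proj_in)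
  also have "\<dots> = - (l1norm ?w / 2)"
    using half_cube_inner_eq_iff[OF y(1), of ?w] y W \<open>?w \<in> W\<close> by (simp add: orth_proj_inner)
  also have "\<dots> \<le> - (x \<bullet> ?w)" using x \<open>?w \<in> W\<close> by (auto simp: zonotope_def)
  also have "\<dots> = a \<bullet> x"
    using neg[OF xW] by simp
  finally show False using ab(1) by simp
qed

section \<open>Faces of the zonotope and their inclusions\<close>

lemma zono_face_eq:
  assumes "subspace W" "w \<in> W" shows "zono_face W w = orth_proj W ` cube_face w"
proof -
  have "zono_face W w = orth_proj W ` {y \<in> half_cube. 2 * (y \<bullet> w) = l1norm w}"
    using assms by (auto simp: zono_face_def zonotope_eq orth_proj_inner)
  also have "{y \<in> half_cube. 2 * (y \<bullet> w) = l1norm w} = cube_face w"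
    using half_cube_inner_eq_iff cube_face_subset by blast
  finally show ?thesis .
qed

lemma zono_face_nonempty:
  assumes "subspace W" "w \<in> W" shows "zono_face W w \<noteq> {}"
  unfolding zono_face_eq[OF assms] using half_sgn_in_cube_face[of w] by blast

lemma zono_face_zero:
  assumes "subspace W" shows "zono_face W 0 = zonotope W"
  by (auto simp: zono_face_def l1norm_def)

text \<open>Forward, the projected centre of the \<open>w\<close>-face lies in the
  \<open>u\<close>-face. Inner products with \<open>u \<in> W\<close> may be computed in the cube,
  so the centre itself lies in \<open>cube_face u\<close> and shows the signs of \<open>u\<close>.
  Backward, the inclusion already holds between the faces of the cube.\<close>

lemma zono_face_subset_iff:
  assumes W: "subspace W" "u \<in> W" "w \<in> W"
  shows "zono_face W w \<subseteq> zono_face W u \<longleftrightarrow> conformal u w"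
proof
  assume sub: "zono_face W w \<subseteq> zono_face W u"
  let ?y = "\<chi> e. sgn (w $ e) / 2"
  have "orth_proj W ?y \<in> zono_face W w"
    using W half_sgn_in_cube_face[of w] by (simp add: zono_face_eq)
  with sub have "orth_proj W ?y \<in> zono_face W u" by auto
  then have "2 * (?y \<bullet> u) = l1norm u" using W by (simp add: zono_face_def orth_proj_inner)
  then have "?y \<in> cube_face u"
    using half_cube_inner_eq_iff[of ?y u] half_sgn_in_cube_face[of w] cube_face_subset[of w] by blast
  then show "conformal u w" by (auto simp: cube_face_def conformal_def)
next
  assume c: "conformal u w"
  have "cube_face w \<subseteq> cube_face u"
  proof
    fix y assume y: "y \<in> cube_face w"
    have "y $ e = sgn (u $ e) / 2" if "u $ e \<noteq> 0" for e
    proof -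
      have "sgn (u $ e) = sgn (w $ e)" using c that by (auto simp: conformal_def)
      moreover from this have "w $ e \<noteq> 0" using that by (auto simp: sgn_zero_iff)
      ultimately show ?thesis using y by (simp add: cube_face_def)
    qed
    then show "y \<in> cube_face u" using y by (auto simp: cube_face_def)
  qed
  then show "zono_face W w \<subseteq> zono_face W u" using W by (auto simp: zono_face_eq)
qed

lemma polytope_zonotope: "subspace W \<Longrightarrow> polytope (zonotope W)"
  by (simp add: zonotope_eq half_cube_eq_cbox polytope_linear_image linear_orth_proj polytope_interval)

lemma zono_face_face_of:
  assumes "subspace W" "w \<in> W" shows "zono_face W w face_of zonotope W"
proof -
  have "zonotope W \<inter> {x. (2 *\<^sub>R w) \<bullet> x = l1norm w} face_of zonotope W"
    using assms polytope_zonotope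
    by (intro face_of_Int_supporting_hyperplane_le polytope_imp_convex)
       (auto simp: zonotope_def inner_commute)
  also have "zonotope W \<inter> {x. (2 *\<^sub>R w) \<bullet> x = l1norm w} = zono_face W w"
    by (auto simp: zono_face_def inner_commute)
  finally show ?thesis .
qed

text \<open>Faces of a polyhedron are exposed, and projecting the exposing functional to
  \<open>W\<close> leaves its values on the zonotope unchanged.\<close>

lemma face_of_zonotope:
  assumes W: "subspace W" and F: "F face_of zonotope W" "F \<noteq> {}"
  obtains w where "w \<in> W" "F = zono_face W w"
proof -
  obtain a b where ab: "zonotope W \<subseteq> {x. a \<bullet> x \<le> b}" "F = zonotope W \<inter> {x. a \<bullet> x = b}"
    using F exposed_face_of_polyhedron[of "zonotope W" F] polytope_zonotope[OF W]
    by (auto simp: polytope_imp_polyhedron exposed_face_of_def)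
  let ?w = "orth_proj W a"
  have w: "?w \<in> W" using W by (rule orth_proj_in)
  have eq: "a \<bullet> x = x \<bullet> ?w" if "x \<in> zonotope W" for x
    using that orth_proj_inner[OF W, of x a] by (auto simp: zonotope_def inner_commute)
  \<comment> \<open>Both sides are twice the maximum of \<open>?w\<close> on the zonotope:
    \<open>b\<close> is attained because \<open>F\<close> is nonempty, and
    \<open>l1norm ?w / 2\<close> is attained on \<open>zono_face W ?w\<close>.\<close>
  have "2 * b = l1norm ?w"
  proof (rule antisym)
    obtain x where "x \<in> F" using F by auto
    then have "x \<in> zonotope W" "x \<bullet> ?w = b" using ab eq by auto
    then show "2 * b \<le> l1norm ?w" using w by (auto simp: zonotope_def)
    obtain x where "x \<in> zono_face W ?w" using zono_face_nonempty[OF W w] by auto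
    then have "x \<in> zonotope W" "2 * (x \<bullet> ?w) = l1norm ?w" by (auto simp: zono_face_def)
    then show "l1norm ?w \<le> 2 * b" using ab(1) eq by auto
  qed
  then have "F = zono_face W ?w" using ab(2) eq by (auto simp: zono_face_def)
  with w show ?thesis by (rule that)
qed

lemma face_of_zonotope_iff:
  assumes "subspace W"
  shows "F face_of zonotope W \<and> F \<noteq> {} \<longleftrightarrow> F \<in> zono_face W ` W"
  using zono_face_face_of[OF assms] zono_face_nonempty[OF assms] face_of_zonotope[OF assms, of F]
  by blast

section \<open>Directions and dimensions of the faces\<close>

lemma subspace_vanish: "subspace {y::real^'e. \<forall>e\<in>H. y $ e = 0}"
  by (auto simp: subspace_def)

lemma span_half_cube_vanish:
  fixes H :: "'e::finite set"
  shows "span {y \<in> half_cube. \<forall>e\<in>H. y $ e = 0} = {y::real^'e. \<forall>e\<in>H. y $ e = 0}"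
    (is "span ?K = ?Y")
proof (rule antisym)
  show "span ?K \<subseteq> ?Y" by (rule span_minimal) (auto simp: subspace_vanish)
  show "?Y \<subseteq> span ?K"
  proof
    fix y :: "real^'e" assume y: "y \<in> ?Y"
    \<comment> \<open>Scales \<open>y\<close> into the cube; the summand \<open>1\<close> covers
      \<open>y = 0\<close>.\<close>
    define c where "c = 1 / (2 * (1 + norm y))"
    have c: "c > 0" unfolding c_def by (simp add: add_pos_nonneg)
    have "\<bar>c * y $ e\<bar> \<le> 1/2" for e
    proof -
      have "\<bar>y $ e\<bar> \<le> 1 + norm y" using component_le_norm_cart[of y e] by simp
      then show ?thesis using norm_ge_zero[of y]
        by (simp add: c_def abs_mult divide_le_eq)
    qed
    then have "c *\<^sub>R y \<in> ?K" using y by (auto simp: half_cube_def)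
    then have "(1/c) *\<^sub>R (c *\<^sub>R y) \<in> span ?K" by (intro span_scale span_base)
    then show "y \<in> span ?K" using c by simp
  qed
qed

text \<open>Splitting off the centre leaves a cube that depends on \<open>w\<close> only through its
  support; hence faces with equal supports are parallel.\<close>

lemma translate_cube_face:
  "cube_face w = (\<lambda>y. (\<chi> e. sgn (w $ e) / 2) + y) ` {y \<in> half_cube. \<forall>e\<in>supp w. y $ e = 0}"
    (is "_ = ?t ` ?K")
proof
  show "?t ` ?K \<subseteq> cube_face w"
  proof
    fix z assume "z \<in> ?t ` ?K"
    then obtain y where y: "y \<in> half_cube" "\<forall>e\<in>supp w. y $ e = 0" "z = ?t y" by auto
    have "\<bar>z $ e\<bar> \<le> 1/2 \<and> (w $ e \<noteq> 0 \<longrightarrow> z $ e = sgn (w $ e) / 2)" for e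
      using y by (cases "w $ e = 0") (auto simp: half_cube_def supp_def sgn_if)
    then show "z \<in> cube_face w" by (simp add: cube_face_def half_cube_def)
  qed
  show "cube_face w \<subseteq> ?t ` ?K"
  proof
    fix z assume z: "z \<in> cube_face w"
    let ?y = "z - (\<chi> e. sgn (w $ e) / 2)"
    have "\<bar>?y $ e\<bar> \<le> 1/2 \<and> (w $ e \<noteq> 0 \<longrightarrow> ?y $ e = 0)" for e
      using z by (cases "w $ e = 0") (auto simp: half_cube_def cube_face_def)
    then have "?y \<in> ?K" by (simp add: half_cube_def supp_def)
    moreover have "z = ?t ?y" by simp
    ultimately show "z \<in> ?t ` ?K" by blast
  qed
qed

lemma zono_face_translate:
  assumes "subspace W" "w \<in> W"
  shows "zono_face W w = (\<lambda>x. orth_proj W (\<chi> e. sgn (w $ e) / 2) + x) `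
    orth_proj W ` {y \<in> half_cube. \<forall>e\<in>supp w. y $ e = 0}"
  using assms
  by (simp add: zono_face_eq translate_cube_face image_image linear_add[OF linear_orth_proj])

lemma zono_face_parallel:
  assumes W: "subspace W" "u \<in> W" "w \<in> W" and eq: "supp u = supp w"
  shows "affine_parallel (affine hull zono_face W u) (affine hull zono_face W w)"
proof -
  define K where "K = orth_proj W ` {y \<in> half_cube. \<forall>e\<in>supp w. y $ e = 0}"
  define a where "a = orth_proj W (\<chi> e. sgn (w $ e) / 2)"
  define b where "b = orth_proj W (\<chi> e. sgn (u $ e) / 2)"
  have "affine hull zono_face W w = (+) a ` (affine hull K)"
    using zono_face_translate[OF W(1,3)] unfolding K_def a_def by (simp add: affine_hull_translation)
  moreover have "affine hull zono_face W u = (+) b ` (affine hull K)"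
    using zono_face_translate[OF W(1,2)] eq unfolding K_def b_def by (simp add: affine_hull_translation)
  ultimately have "affine hull zono_face W w = (\<lambda>x. (a - b) + x) ` (affine hull zono_face W u)"
    by (simp add: image_image add.assoc)
  then show ?thesis unfolding affine_parallel_def by blast
qed

text \<open>The support of \<open>w\<close> is recovered from the directions of its face: a
  coordinate outside it can be varied within the face, which changes the value of any
  \<open>u\<close> that is nonzero there.\<close>

lemma constant_on_zono_face_iff:
  assumes W: "subspace W" "w \<in> W" "u \<in> W"
  shows "(\<exists>c. \<forall>x\<in>zono_face W w. x \<bullet> u = c) \<longleftrightarrow> supp u \<subseteq> supp w"
proof
  assume "\<exists>c. \<forall>x\<in>zono_face W w. x \<bullet> u = c"
  then obtain c where c: "\<And>x. x \<in> zono_face W w \<Longrightarrow> x \<bullet> u = c" by auto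
  \<comment> \<open>The centre moved to the boundary of the cube along the free coordinate
    \<open>e\<close>.\<close>
  let ?y = "\<lambda>e. (\<chi> e. sgn (w $ e) / 2) + axis e (1/2) :: real^'a"
  show "supp u \<subseteq> supp w"
  proof (rule subsetI, rule ccontr)
    fix e assume e: "e \<in> supp u" "e \<notin> supp w"
    have "axis e (1/2) \<in> {y \<in> half_cube. \<forall>e\<in>supp w. y $ e = 0}"
      using e by (auto simp: half_cube_def axis_def)
    then have "?y e \<in> cube_face w" unfolding translate_cube_face by blast
    then have "orth_proj W (?y e) \<bullet> u = c"
      using c W by (auto simp: zono_face_eq)
    moreover have "orth_proj W (\<chi> e. sgn (w $ e) / 2) \<bullet> u = c"
      using c W half_sgn_in_cube_face[of w] by (simp add: zono_face_eq)
    ultimately have "axis e (1/2) \<bullet> u = 0" using W by (simp add: orth_proj_inner inner_add_left)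
    then show False using e by (simp add: inner_axis' supp_def)
  qed
next
  assume sub: "supp u \<subseteq> supp w"
  have "x \<bullet> u = (\<chi> e. sgn (w $ e) / 2) \<bullet> u" if "x \<in> zono_face W w" for x
  proof -
    from that obtain y where y: "y \<in> cube_face w" "x = orth_proj W y" using W by (auto simp: zono_face_eq)
    have "y \<bullet> u = (\<chi> e. sgn (w $ e) / 2) \<bullet> u"
      unfolding inner_vec_def using y sub
      by (intro sum.cong refl) (auto simp: cube_face_def supp_def subset_iff)
    then show ?thesis using W y by (simp add: orth_proj_inner)
  qed
  then show "\<exists>c. \<forall>x\<in>zono_face W w. x \<bullet> u = c" by blast
qed

text \<open>A level set of \<open>u\<close> is affine, so it contains the affine hull; a translation
  only shifts the constant.\<close>

lemma affine_parallel_constant: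
  fixes S T :: "'a::real_inner set"
  assumes par: "affine_parallel (affine hull S) (affine hull T)" and c: "\<exists>c. \<forall>x\<in>S. x \<bullet> u = c"
  shows "\<exists>c. \<forall>x\<in>T. x \<bullet> u = c"
proof -
  from c obtain c where "S \<subseteq> {x. u \<bullet> x = c}" by (auto simp: inner_commute)
  then have "affine hull S \<subseteq> {x. u \<bullet> x = c}" by (rule hull_minimal) (rule affine_hyperplane)
  moreover obtain a where "affine hull T = (\<lambda>x. a + x) ` (affine hull S)"
    using par by (auto simp: affine_parallel_def)
  then have "T \<subseteq> (\<lambda>x. a + x) ` (affine hull S)" using hull_subset by metis
  ultimately have "\<forall>x\<in>T. x \<bullet> u = a \<bullet> u + c"
    by (auto simp: inner_add_left inner_commute inner_add_right subset_iff)
  then show ?thesis by blast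
qed

text \<open>The direction space of the face is the projection of the coordinate subspace
  \<open>?Y\<close>. Its orthogonal complement in \<open>W\<close> consists of the members of
  \<open>W\<close> supported in \<open>supp w\<close>, and the two dimensions add up to
  \<open>dim W\<close>.\<close>

lemma aff_dim_zono_face:
  assumes W: "subspace W" "w \<in> W"
  shows "aff_dim (zono_face W w) = int (dim W) - int (dim (restrict_support W (supp w)))"
proof -
  let ?Y = "{y::real^'a. \<forall>e\<in>supp w. y $ e = 0}"
  let ?K = "{y \<in> half_cube. \<forall>e\<in>supp w. y $ e = 0} :: (real^'a) set"
  have lin: "linear (orth_proj W)" using W(1) by (rule linear_orth_proj)
  have "0 \<in> ?K" by (auto simp: half_cube_def)
  then have zero: "0 \<in> orth_proj W ` ?K" using imageI[of 0 ?K "orth_proj W"] by (simp add: linear_0[OF lin])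
  have "aff_dim (zono_face W w) = aff_dim (orth_proj W ` ?K)"
    unfolding zono_face_translate[OF W] by (rule aff_dim_translation_eq)
  also have "\<dots> = int (dim (orth_proj W ` ?K))"
    using zero by (intro aff_dim_zero) (rule hull_inc)
  also have "dim (orth_proj W ` ?K) = dim (orth_proj W ` ?Y)"
    using linear_span_image[OF lin, of ?K] dim_span[of "orth_proj W ` ?K"]
    by (simp add: span_half_cube_vanish)
  finally have 1: "aff_dim (zono_face W w) = int (dim (orth_proj W ` ?Y))" .
  have "dim {y \<in> W. \<forall>x\<in>orth_proj W ` ?Y. orthogonal x y} + dim (orth_proj W ` ?Y) = dim W"
    using W lin
    by (intro dim_subspace_orthogonal_to_vectors linear_subspace_image subspace_vanish)
       (auto simp: orth_proj)
  moreover have "{y \<in> W. \<forall>x\<in>orth_proj W ` ?Y. orthogonal x y} = restrict_support W (supp w)"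
  proof -
    have "(\<forall>x\<in>?Y. x \<bullet> y = 0) \<longleftrightarrow> (\<forall>e. e \<notin> supp w \<longrightarrow> y $ e = 0)" for y
    proof
      assume a: "\<forall>x\<in>?Y. x \<bullet> y = 0"
      show "\<forall>e. e \<notin> supp w \<longrightarrow> y $ e = 0"
      proof (intro allI impI)
        fix e assume "e \<notin> supp w"
        then have "axis e 1 \<in> ?Y" by (auto simp: axis_def)
        then show "y $ e = 0" using a by (auto simp: inner_axis')
      qed
    next
      assume a: "\<forall>e. e \<notin> supp w \<longrightarrow> y $ e = 0"
      then have "x $ e * y $ e = 0" if "x \<in> ?Y" for x e
        using that by (cases "e \<in> supp w") auto
      then show "\<forall>x\<in>?Y. x \<bullet> y = 0" by (auto simp: inner_vec_def intro!: sum.neutral)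
    qed
    moreover have "(\<forall>x\<in>orth_proj W ` ?Y. orthogonal x y) \<longleftrightarrow> (\<forall>x\<in>?Y. x \<bullet> y = 0)" if "y \<in> W" for y
      using W that by (simp add: orthogonal_def orth_proj_inner)
    ultimately show ?thesis unfolding restrict_support_def by blast
  qed
  ultimately show ?thesis using 1 by simp
qed

lemma aff_dim_zonotope:
  fixes W :: "(real^'e::finite) set"
  assumes W: "subspace W" shows "aff_dim (zonotope W) = int (dim W)"
proof -
  have "restrict_support W (supp 0) = {0}"
    using W by (auto simp: restrict_support_def supp_def vec_eq_iff subspace_0)
  then show ?thesis
    using aff_dim_zono_face[OF W subspace_0[OF W]] zono_face_zero[OF W] by simp
qed

section \<open>Flows and strong orientations\<close>

text \<open>Net inflow. As one sum over all arcs it is visibly linear, and the two terms of a loop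
  cancel.\<close>

definition divergence :: "('v, 'e::finite) pre_digraph \<Rightarrow> real^'e \<Rightarrow> 'v \<Rightarrow> real" where
  "divergence G x v = (\<Sum>e\<in>arcs G. x $ e * (of_bool (head G e = v) - of_bool (tail G e = v)))"

definition flow_space :: "('v, 'e::finite) pre_digraph \<Rightarrow> (real^'e) set" where
  "flow_space G = {x. supp x \<subseteq> arcs G \<and> (\<forall>v\<in>verts G. divergence G x v = 0)}"

definition sign_pattern :: "real^'e \<Rightarrow> 'e oriented_subgraph" where
  "sign_pattern x = (supp x, \<lambda>e. if x $ e = 0 then 0 else if x $ e > 0 then 1 else - 1)"

lemma fst_sign_pattern [simp]: "fst (sign_pattern x) = supp x"
  by (simp add: sign_pattern_def)

lemma of_int_sign_pattern: "of_int (snd (sign_pattern x) e) = sgn (x $ e)"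
  by (simp add: sign_pattern_def)

lemma oriented_subgraph_le_sign_pattern:
  "oriented_subgraph_le (sign_pattern w) (sign_pattern u) \<longleftrightarrow> conformal u w"
proof -
  have "snd (sign_pattern u) e = snd (sign_pattern w) e \<longleftrightarrow> sgn (u $ e) = sgn (w $ e)" for e
    by (metis of_int_sign_pattern of_int_eq_iff)
  moreover have "oriented_subgraph_le (sign_pattern w) (sign_pattern u) \<longleftrightarrow>
      supp u \<subseteq> supp w \<and> (\<forall>e\<in>supp u. snd (sign_pattern u) e = snd (sign_pattern w) e)"
    by (simp add: oriented_subgraph_le_def split_beta)
  moreover have "sgn (u $ e) = sgn (w $ e) \<Longrightarrow> u $ e \<noteq> 0 \<longleftrightarrow> w $ e \<noteq> 0" for e
    by (metis sgn_zero_iff)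
  ultimately show ?thesis by (auto simp: conformal_def supp_def)
qed

lemma is_oriented_sign_pattern:
  "supp x \<subseteq> arcs G \<Longrightarrow> is_oriented_subgraph G (sign_pattern x)"
  by (auto simp: is_oriented_subgraph_def sign_pattern_def supp_def)

lemma in_minus_out_arcs:
  fixes x :: "real^'e::finite"
  shows "(\<Sum>e\<in>in_arcs G v. x $ e) - (\<Sum>e\<in>out_arcs G v. x $ e) = divergence G x v"
proof -
  have "(\<Sum>e\<in>in_arcs G v. x $ e) = (\<Sum>e\<in>arcs G. x $ e * of_bool (head G e = v))"
    unfolding in_arcs_def by (intro sum.mono_neutral_cong_left) auto
  moreover have "(\<Sum>e\<in>out_arcs G v. x $ e) = (\<Sum>e\<in>arcs G. x $ e * of_bool (tail G e = v))"
    unfolding out_arcs_def by (intro sum.mono_neutral_cong_left) auto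
  ultimately show ?thesis
    by (simp add: divergence_def sum_subtractf right_diff_distrib)
qed

lemma flow_lattice_eq: "flow_lattice G = {x \<in> flow_space G. \<forall>e. x $ e \<in> \<int>}"
  unfolding flow_lattice_def flow_space_def in_minus_out_arcs[symmetric] supp_def by auto

lemma divergence_add: "divergence G (x + y) v = divergence G x v + divergence G y v"
  by (simp add: divergence_def sum.distrib distrib_right)

lemma divergence_scale: "divergence G (c *\<^sub>R x) v = c * divergence G x v"
  by (simp add: divergence_def sum_distrib_left mult.assoc)

lemma divergence_zero: "divergence G 0 v = 0"
  by (simp add: divergence_def)

lemma divergence_axis:
  "e \<in> arcs G \<Longrightarrow>
    divergence G (axis e c) v = c * (of_bool (head G e = v) - of_bool (tail G e = v))"
  by (subst divergence_def, subst sum.remove[of _ e]) (auto simp: axis_def intro!: sum.neutral)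

lemma supp_add: "supp (x + y) \<subseteq> supp x \<union> supp y"
  by (auto simp: supp_def)

lemma supp_scale: "supp (c *\<^sub>R x) = (if c = 0 then {} else supp x)"
  by (auto simp: supp_def)

lemma supp_zero [simp]: "supp 0 = {}"
  by (auto simp: supp_def)

lemma subspace_flow_space: "subspace (flow_space G)"
proof (rule subspaceI)
  show "x + y \<in> flow_space G" if "x \<in> flow_space G" "y \<in> flow_space G" for x y
    using that supp_add[of x y] by (auto simp: flow_space_def divergence_add)
qed (auto simp: flow_space_def divergence_scale divergence_zero supp_scale)

text \<open>Connects the codimension of a face, which is a dimension of restricted flows, to the
  \<open>genus\<close> of the subgraph.\<close>

lemma restrict_support_flow_space:
  assumes "H \<subseteq> arcs G"
  shows "restrict_support (flow_space G) H = flow_space (spanning_sub G H)"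
proof -
  have "divergence (spanning_sub G H) x v = divergence G x v" if "supp x \<subseteq> H" for x v
    unfolding divergence_def spanning_sub_def using assms that
    by (intro sum.mono_neutral_cong_left) (auto simp: supp_def)
  moreover have "(\<forall>e. e \<notin> H \<longrightarrow> x $ e = 0) \<longleftrightarrow> supp x \<subseteq> H" for x
    by (auto simp: supp_def)
  ultimately show ?thesis using assms unfolding restrict_support_def flow_space_def
    by (auto simp: spanning_sub_def)
qed

section \<open>Flows along an oriented subgraph\<close>

text \<open>Directed walks are taken in \<open>D\<close>, divergences in the reference orientation
  of \<open>G\<close>; the sign \<open>snd A e\<close> converts between the two.\<close>

locale oriented_subgraph_digraph = fin_digraph G for G :: "('v, 'e::finite) pre_digraph" (structure) +
  fixes A :: "'e oriented_subgraph"
  assumes oriented: "is_oriented_subgraph G A"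
begin

abbreviation D :: "('v, 'e) pre_digraph" where "D \<equiv> oriented_digraph G A"

lemma D_simps [simp]:
  "verts D = verts G" "arcs D = fst A"
  by (auto simp: oriented_digraph_def split: prod.splits)

lemma D_ends:
  "tail D = (\<lambda>e. if snd A e = 1 then tail G e else head G e)"
  "head D = (\<lambda>e. if snd A e = 1 then head G e else tail G e)"
  by (auto simp: oriented_digraph_def split: prod.splits)

lemma A_props: "fst A \<subseteq> arcs G" "e \<in> fst A \<Longrightarrow> snd A e = 1 \<or> snd A e = -1" "e \<notin> fst A \<Longrightarrow> snd A e = 0"
  using oriented by (auto simp: is_oriented_subgraph_def split: prod.splits)

sublocale D: fin_digraph D
proof
  show "e \<in> arcs D \<Longrightarrow> tail D e \<in> verts D" "e \<in> arcs D \<Longrightarrow> head D e \<in> verts D" for e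
    using A_props(1) by (auto simp: D_ends)
qed auto

text \<open>Where \<open>A\<close> reverses the reference direction, both the coefficient and the
  difference of the indicators change sign.\<close>

lemma divergence_eq:
  assumes "supp x \<subseteq> fst A"
  shows "divergence G x v =
    (\<Sum>e\<in>fst A. of_int (snd A e) * x $ e * (of_bool (head D e = v) - of_bool (tail D e = v)))"
proof -
  have "divergence G x v = (\<Sum>e\<in>fst A. x $ e * (of_bool (head G e = v) - of_bool (tail G e = v)))"
    unfolding divergence_def using assms A_props(1)
    by (intro sum.mono_neutral_right) (auto simp: supp_def)
  also have "\<dots> = (\<Sum>e\<in>fst A. of_int (snd A e) * x $ e * (of_bool (head D e = v) - of_bool (tail D e = v)))"
    using A_props(2) by (intro sum.cong refl) (force simp: D_ends of_bool_def)
  finally show ?thesis .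
qed

lemma divergence_arc:
  assumes "e \<in> fst A"
  shows "divergence G (axis e (of_int (snd A e))) v = of_bool (head D e = v) - of_bool (tail D e = v)"
  using assms A_props(1) A_props(2)[OF assms] by (auto simp: D_ends divergence_axis)

text \<open>Every arc of the walk contributes one unit in its direction in \<open>D\<close>. The
  sign condition says that the flow runs along the orientation.\<close>

lemma unit_flow_of_reachable:
  assumes "u \<rightarrow>\<^sup>*\<^bsub>D\<^esub> v"
  shows "\<exists>x::real^'e. supp x \<subseteq> fst A \<and> (\<forall>e. 0 \<le> of_int (snd A e) * x $ e) \<and>
    (\<forall>w. divergence G x w = of_bool (v = w) - of_bool (u = w))"
  using assms
proof (induct rule: D.reachable_induct)
  case base
  show ?case by (rule exI[of _ 0]) (simp add: divergence_zero supp_def)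
next
  case (step v w)
  then obtain x :: "real^'e" where x: "supp x \<subseteq> fst A" "\<forall>e. 0 \<le> of_int (snd A e) * x $ e"
    "\<forall>w. divergence G x w = of_bool (v = w) - of_bool (u = w)" by blast
  from \<open>v \<rightarrow>\<^bsub>D\<^esub> w\<close> obtain e where e: "e \<in> fst A" "tail D e = v" "head D e = w"
    by (metis D_simps(2) reachableE)
  let ?y = "x + axis e (of_int (snd A e))"
  have "supp ?y \<subseteq> fst A" using x(1) e(1) by (auto simp: supp_def axis_def)
  moreover have "0 \<le> of_int (snd A e') * ?y $ e'" for e'
    using x(2) by (auto simp: axis_def distrib_left)
  moreover have "divergence G ?y z = of_bool (w = z) - of_bool (u = z)" for z
    using x(3) divergence_arc[OF e(1), of z] e by (simp add: divergence_add)
  ultimately show ?case by blast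
qed

text \<open>The contributions of the arcs telescope along the walk; distinctness makes the indicator
  vector the sum of the single arcs.\<close>

lemma divergence_walk:
  assumes "D.cas u p v" "distinct p" "set p \<subseteq> fst A"
  shows "divergence G (\<chi> e. if e \<in> set p then of_int (snd A e) else 0) w = of_bool (v = w) - of_bool (u = w)"
  using assms
proof (induct p arbitrary: u)
  case Nil
  have "(\<chi> e. 0) = (0::real^'e)" by (simp add: vec_eq_iff)
  with Nil show ?case by (simp add: divergence_zero)
next
  case (Cons a p)
  have "(\<chi> e. if e \<in> set (a # p) then of_int (snd A e) else 0) =
    axis a (of_int (snd A a)) + (\<chi> e. if e \<in> set p then of_int (snd A e) else (0::real))"
    using Cons.prems by (auto simp: vec_eq_iff axis_def)
  moreover have "D.cas (head D a) p v" "tail D a = u" using Cons.prems by auto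
  ultimately show ?case
    using Cons.hyps[of "head D a"] Cons.prems divergence_arc[of a w]
    by (simp add: divergence_add)
qed

lemma cas_nth:
  "D.cas u p v \<Longrightarrow> Suc i < length p \<Longrightarrow> tail D (p ! Suc i) = head D (p ! i)"
proof (induct p arbitrary: u i)
  case (Cons a p)
  then show ?case by (cases i; cases p) auto
qed simp

text \<open>Strong connectivity of the component of \<open>e\<close> gives a directed way back.
  Conversely, if every arc has one, backward steps of an undirected walk can be replaced by directed
  walks, so connected and strong components agree.\<close>

lemma connected_components_reachable:
  "(\<forall>K\<in>connected_components D. strongly_connected (D \<restriction> K)) \<longleftrightarrow>
   (\<forall>e\<in>fst A. head D e \<rightarrow>\<^sup>*\<^bsub>D\<^esub> tail D e)" (is "?L \<longleftrightarrow> ?R")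
proof -
  let ?S = "with_proj (mk_symmetric D)"
  interpret S: pair_wf_digraph "mk_symmetric D" by (rule D.wellformed_mk_symmetric)
  have ends: "(head D e, tail D e) \<in> arcs_ends ?S" "(tail D e, head D e) \<in> arcs_ends ?S"
    if "e \<in> fst A" for e
    using that by (auto simp: parcs_mk_symmetric)
  show ?thesis
  proof
    assume L: ?L
    show ?R
    proof
      fix e assume e: "e \<in> fst A"
      let ?K = "pre_digraph.scc_of ?S (tail D e)"
      have tv: "tail D e \<in> verts D" using e by (intro D.tail_in_verts) simp
      have K: "?K \<in> connected_components D"
        unfolding connected_components_def using tv by (intro S.scc_of_in_sccs_verts) auto
      have in1: "tail D e \<in> ?K" using tv by (intro S.in_scc_of_self) auto
      have in2: "head D e \<in> ?K"
        using ends[OF e] unfolding S.scc_of_def by auto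
      have "?K \<subseteq> verts D" using S.sccs_verts_subsets K by (auto simp: connected_components_def)
      then have "subgraph (D \<restriction> ?K) D" by (intro induced_imp_subgraph D.induced_induce)
      moreover have "head D e \<rightarrow>\<^sup>*\<^bsub>D \<restriction> ?K\<^esub> tail D e"
        using L K in1 in2 by (auto simp: strongly_connected_def)
      ultimately show "head D e \<rightarrow>\<^sup>*\<^bsub>D\<^esub> tail D e" by (intro D.reachable_mono)
    qed
  next
    assume R: ?R
    have eq: "u \<rightarrow>\<^sup>*\<^bsub>?S\<^esub> v \<longleftrightarrow> u \<rightarrow>\<^sup>*\<^bsub>D\<^esub> v" for u v
    proof
      assume "u \<rightarrow>\<^sup>*\<^bsub>?S\<^esub> v"
      then show "u \<rightarrow>\<^sup>*\<^bsub>D\<^esub> v"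
      proof (induct rule: S.reachable_induct)
        case base then show ?case by simp
      next
        case (step v w)
        from step(2) obtain e where e: "e \<in> fst A" and
          "v = tail D e \<and> w = head D e \<or> v = head D e \<and> w = tail D e"
          by (auto simp: parcs_mk_symmetric)
        then have "v \<rightarrow>\<^sup>*\<^bsub>D\<^esub> w"
          using R e D.in_arcs_imp_in_arcs_ends[of e] by auto
        with step(3) show ?case by (rule D.reachable_trans)
      qed
    qed (rule D.reachable_mk_symmetricI)
    have "connected_components D = D.sccs_verts"
      unfolding connected_components_def S.sccs_verts_def D.sccs_verts_def eq ..
    then show ?L using D.in_sccsE[OF D.in_verts_sccsD_sccs] by auto
  qed
qed

lemma strongly_oriented_iff:
  "A \<in> strongly_oriented_subgraphs G \<longleftrightarrow> (\<forall>e\<in>fst A. head D e \<rightarrow>\<^sup>*\<^bsub>D\<^esub> tail D e)"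
  using connected_components_reachable oriented by (simp add: strongly_oriented_subgraphs_def)

text \<open>
  Summing the divergence over the set of vertices reachable from the head of \<open>e\<close>: no arc leaves
  this set, so no arc enters it either.
\<close>

lemma reversible_of_flow:
  assumes A: "A = sign_pattern x" and x: "x \<in> flow_space G" and e: "e \<in> fst A"
  shows "head D e \<rightarrow>\<^sup>*\<^bsub>D\<^esub> tail D e"
proof -
  define R where "R = {v. head D e \<rightarrow>\<^sup>*\<^bsub>D\<^esub> v}"
  have R: "R \<subseteq> verts G" "finite R"
    using D.reachable_in_verts finite_subset[of R "verts G"] unfolding R_def by auto
  have pos: "of_int (snd A a) * x $ a > 0" if "a \<in> fst A" for a
    using that by (auto simp: A sign_pattern_def supp_def)
  \<comment> \<open>The contribution of \<open>a\<close> to the net flow into \<open>R\<close>; arcs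
    with both ends on the same side contribute \<open>0\<close>.\<close>
  define f where "f a = of_int (snd A a) * x $ a *
    (of_bool (head D a \<in> R) - of_bool (tail D a \<in> R))" for a
  have "(\<Sum>v\<in>R. divergence G x v) = (\<Sum>a\<in>fst A. f a)"
  proof -
    have "(\<Sum>v\<in>R. divergence G x v) = (\<Sum>a\<in>fst A. \<Sum>v\<in>R. of_int (snd A a) * x $ a *
        (of_bool (head D a = v) - of_bool (tail D a = v)))"
      using A by (simp add: divergence_eq sum.swap[of _ R])
    also have "\<dots> = (\<Sum>a\<in>fst A. f a)"
      using R(2) unfolding f_def
      by (simp add: sum_distrib_left[symmetric] sum_subtractf of_bool_def)
    finally show ?thesis .
  qed
  also have "(\<Sum>v\<in>R. divergence G x v) = 0"
    using x R by (auto simp: flow_space_def intro!: sum.neutral)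
  finally have "(\<Sum>a\<in>fst A. f a) = 0" by simp
  moreover have "0 \<le> f a" if a: "a \<in> fst A" for a
  proof -
    have "tail D a \<in> R \<Longrightarrow> head D a \<in> R"
      using a D.in_arcs_imp_in_arcs_ends[of a] unfolding R_def
      by (auto intro: D.reachable_adj_trans)
    then have "(0::real) \<le> of_bool (head D a \<in> R) - of_bool (tail D a \<in> R)" by auto
    then show ?thesis unfolding f_def by (rule mult_nonneg_nonneg[OF less_imp_le[OF pos[OF a]]])
  qed
  ultimately have "f e = 0" using e by (subst (asm) sum_nonneg_eq_0_iff) auto
  moreover have "head D e \<in> R" unfolding R_def using D.head_in_verts[of e] e by simp
  ultimately have "tail D e \<in> R" using pos[OF e] unfolding f_def by (cases "tail D e \<in> R") auto
  then show ?thesis by (simp add: R_def)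
qed

text \<open>Each arc \<open>e\<close> closes a directed walk from its head back to its tail to a
  flow that uses \<open>e\<close> and runs nowhere against the orientation; the sum over all
  \<open>e\<close> uses every arc in its direction.\<close>

lemma flow_of_strongly_oriented:
  assumes "A \<in> strongly_oriented_subgraphs G"
  shows "\<exists>x\<in>flow_space G. sign_pattern x = A"
proof -
  have "\<exists>y::real^'e. supp y \<subseteq> fst A \<and> (\<forall>a. 0 \<le> of_int (snd A a) * y $ a) \<and>
    (\<forall>w. divergence G y w = 0) \<and> of_int (snd A e) * y $ e > 0" if e: "e \<in> fst A" for e
  proof -
    have "head D e \<rightarrow>\<^sup>*\<^bsub>D\<^esub> tail D e" using assms e by (simp add: strongly_oriented_iff)
    from unit_flow_of_reachable[OF this] obtain x :: "real^'e" where
      x: "supp x \<subseteq> fst A" "\<And>a. 0 \<le> of_int (snd A a) * x $ a"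
        "\<And>w. divergence G x w = of_bool (tail D e = w) - of_bool (head D e = w)" by blast
    let ?y = "x + axis e (of_int (snd A e))"
    have "supp ?y \<subseteq> fst A" using x(1) e by (auto simp: supp_def axis_def)
    moreover have "0 \<le> of_int (snd A a) * ?y $ a" for a
      using x(2)[of a] by (auto simp: axis_def distrib_left)
    moreover have "divergence G ?y w = 0" for w
      using x(3) divergence_arc[OF e, of w] by (simp add: divergence_add)
    moreover have "of_int (snd A e) * ?y $ e > 0"
      using x(2)[of e] A_props(2)[OF e] by (auto simp: axis_def distrib_left)
    ultimately show ?thesis by blast
  qed
  then obtain y :: "'e \<Rightarrow> real^'e" where y: "\<And>e. e \<in> fst A \<Longrightarrow> supp (y e) \<subseteq> fst A"
    "\<And>e a. e \<in> fst A \<Longrightarrow> 0 \<le> of_int (snd A a) * y e $ a"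
    "\<And>e w. e \<in> fst A \<Longrightarrow> divergence G (y e) w = 0"
    "\<And>e. e \<in> fst A \<Longrightarrow> of_int (snd A e) * y e $ e > 0" by metis
  define x where "x = (\<Sum>e\<in>fst A. y e)"
  have "y e \<in> flow_space G" if "e \<in> fst A" for e
    using y(1,3)[OF that] A_props(1) by (auto simp: flow_space_def)
  then have "x \<in> flow_space G"
    unfolding x_def by (intro subspace_sum subspace_flow_space)
  moreover have "sign_pattern x = A"
  proof -
    have "of_int (snd A a) * x $ a > 0" if a: "a \<in> fst A" for a
    proof -
      have "of_int (snd A a) * x $ a = (\<Sum>e\<in>fst A. of_int (snd A a) * y e $ a)"
        by (simp add: x_def sum_distrib_left)
      also have "\<dots> > 0" using a y(2,4) by (intro sum_pos2[of _ a]) auto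
      finally show ?thesis .
    qed
    moreover have "x $ a = 0" if "a \<notin> fst A" for a
      unfolding x_def sum_component using y(1) that by (intro sum.neutral) (auto simp: supp_def)
    ultimately have s: "if a \<in> fst A then of_int (snd A a) * x $ a > 0 else x $ a = 0" for a by simp
    have "x $ a \<noteq> 0 \<longleftrightarrow> a \<in> fst A" for a using s[of a] by (auto split: if_splits)
    then have "supp x = fst A" by (auto simp: supp_def)
    moreover have "snd (sign_pattern x) a = snd A a" for a
      using s[of a] A_props(2,3)[of a] by (auto simp: sign_pattern_def split: if_splits)
    ultimately show ?thesis by (intro prod_eqI) auto
  qed
  ultimately show ?thesis by blast
qed

lemma cycle_through:
  assumes e: "e \<in> fst A" and r: "head D e \<rightarrow>\<^sup>*\<^bsub>D\<^esub> tail D e"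
  obtains C where "C \<in> oriented_circuits G" "e \<in> fst C" "oriented_subgraph_le A C"
proof -
  \<comment> \<open>A path without repeated vertices: after closing up by \<open>e\<close> only the
    base vertex occurs twice, and \<open>tl\<close> removes one of its copies.\<close>
  obtain p where p: "D.apath (head D e) p (tail D e)"
    using r D.reachable_apath by blast
  define q where "q = e # p"
  have q: "D.awalk (tail D e) q (tail D e)" "distinct (tl (D.awalk_verts (tail D e) q))" "e \<in> set q"
    using p e by (auto simp: q_def D.apath_def D.awalk_Cons_iff)
  have sub: "set q \<subseteq> fst A" using q(1) by (auto simp: D.awalk_def)
  define C where "C = (set q, \<lambda>a. if a \<in> set q then snd A a else 0)"
  have C: "is_oriented_subgraph G C" "fst C = set q"
    using A_props sub by (auto simp: C_def is_oriented_subgraph_def)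
  \<comment> \<open>\<open>C\<close> keeps the directions of \<open>D\<close> on its arcs, so the
    closed walk is also one in the digraph of \<open>C\<close>.\<close>
  have ends: "tail (oriented_digraph G C) a = tail D a" "head (oriented_digraph G C) a = head D a"
    if "a \<in> set q" for a
    using that by (simp_all add: D_ends) (simp_all add: C_def oriented_digraph_def)
  have "pre_digraph.cas (oriented_digraph G C) u p' v = D.cas u p' v" if "set p' \<subseteq> set q" for u p' v
    using that by (induct p' arbitrary: u) (auto simp: pre_digraph.cas.simps ends)
  moreover have "verts (oriented_digraph G C) = verts D" "arcs (oriented_digraph G C) = set q"
    by (simp_all add: C_def) (simp_all add: oriented_digraph_def)
  ultimately have "pre_digraph.awalk (oriented_digraph G C) (tail D e) q (tail D e)"
    using q(1) by (simp add: pre_digraph.awalk_def)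
  moreover have "pre_digraph.awalk_verts (oriented_digraph G C) u p' = D.awalk_verts u p'"
    if "set p' \<subseteq> set q" for u p'
    using that by (induct p' arbitrary: u) (auto simp: pre_digraph.awalk_verts.simps ends)
  then have "pre_digraph.awalk_verts (oriented_digraph G C) (tail D e) q = D.awalk_verts (tail D e) q"
    by simp
  moreover have "q \<noteq> []" by (simp add: q_def)
  ultimately have "pre_digraph.cycle (oriented_digraph G C) q"
    unfolding pre_digraph.cycle_def using q(2) by metis
  then have "C \<in> oriented_circuits G" using C by (auto simp: oriented_circuits_def)
  moreover have "oriented_subgraph_le A C"
    using sub by (auto simp: oriented_subgraph_le_def C_def split: prod.splits)
  ultimately show ?thesis using that q(3) C(2) by auto
qed

end

text \<open>The passage from graphs to linear algebra: closed walks add up to a flow, and conversely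
  a flow with these signs lets no arc enter a set that no arc leaves.\<close>

lemma strongly_oriented_subgraphs_eq:
  fixes G :: "('v, 'e::finite) pre_digraph"
  assumes "fin_digraph G"
  shows "strongly_oriented_subgraphs G = sign_pattern ` flow_space G"
proof (intro equalityI subsetI)
  fix A assume A: "A \<in> strongly_oriented_subgraphs G"
  then interpret oriented_subgraph_digraph G A
    using assms by (simp add: oriented_subgraph_digraph_def oriented_subgraph_digraph_axioms_def
        strongly_oriented_subgraphs_def)
  show "A \<in> sign_pattern ` flow_space G"
    using flow_of_strongly_oriented[OF A] by blast
next
  fix A assume "A \<in> sign_pattern ` flow_space G"
  then obtain x where x: "x \<in> flow_space G" "A = sign_pattern x" by blast
  then interpret oriented_subgraph_digraph G A
    using assms by (simp add: oriented_subgraph_digraph_def oriented_subgraph_digraph_axioms_def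
        is_oriented_sign_pattern flow_space_def)
  show "A \<in> strongly_oriented_subgraphs G"
    using reversible_of_flow[OF x(2,1)] by (simp add: strongly_oriented_iff)
qed

section \<open>Circuit elements\<close>

text \<open>All facts come from a closed walk \<open>p\<close> through the arcs. Its signed
  indicator telescopes to a flow. Each vertex on it is the head of one arc and the tail of one, so
  conservation leaves only multiples of this flow.\<close>

lemma circuit_element_props:
  fixes G :: "('v, 'e::finite) pre_digraph"
  assumes G: "fin_digraph G" and C: "C \<in> oriented_circuits G"
  shows circuit_element_flow: "circuit_element C \<in> flow_lattice G"
    and sign_pattern_circuit_element: "sign_pattern (circuit_element C) = C"
    and oriented_circuit_nonempty: "fst C \<noteq> {}"
    and l1norm_circuit_element: "l1norm (circuit_element C) = circuit_element C \<bullet> circuit_element C"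
    and restrict_support_circuit:
      "restrict_support (flow_space G) (fst C) = range (\<lambda>c. c *\<^sub>R circuit_element C)"
proof -
  interpret oriented_subgraph_digraph G C
    using G C by (simp add: oriented_subgraph_digraph_def oriented_subgraph_digraph_axioms_def
        oriented_circuits_def)
  obtain p where "D.cycle p" and p: "set p = fst C" using C by (auto simp: oriented_circuits_def)
  then obtain u where walk: "D.awalk u p u" and dist: "distinct (tl (D.awalk_verts u p))" and ne: "p \<noteq> []"
    by (auto simp: D.cycle_def)
  have cas: "D.cas u p u" using walk by (simp add: D.awalk_def)
  \<comment> \<open>The vertices of the walk after the first are the heads of its arcs.\<close>
  have heads: "distinct (map (head D) p)"
    using dist ne by (simp add: D.awalk_verts_conv'[OF cas])
  then have "distinct p" by (simp add: distinct_map)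
  have elem: "circuit_element C = (\<chi> e. if e \<in> set p then of_int (snd C e) else 0)"
    using A_props(3) p by (auto simp: circuit_element_def vec_eq_iff)
  have val: "circuit_element C $ e = of_int (snd C e)" for e by (simp add: circuit_element_def)
  have supp: "supp (circuit_element C) = fst C"
    using A_props(2,3) by (force simp: supp_def val)
  have "divergence G (circuit_element C) w = 0" for w
    using divergence_walk[OF cas \<open>distinct p\<close>] p unfolding elem by simp
  then have flow: "circuit_element C \<in> flow_space G"
    using supp A_props(1) by (simp add: flow_space_def)
  then show "circuit_element C \<in> flow_lattice G"
    by (simp add: flow_lattice_eq val)
  show "sign_pattern (circuit_element C) = C"
  proof (rule prod_eqI)
    show "snd (sign_pattern (circuit_element C)) = snd C"
    proof
      fix e show "snd (sign_pattern (circuit_element C)) e = snd C e"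
        using A_props(2,3)[of e] by (cases "e \<in> fst C") (auto simp: sign_pattern_def val)
    qed
  qed (simp add: supp)
  show "fst C \<noteq> {}" using ne p by auto
  have "\<bar>circuit_element C $ e\<bar> = circuit_element C $ e * circuit_element C $ e" for e
    using A_props(2,3)[of e] by (cases "e \<in> fst C") (auto simp: val)
  then show "l1norm (circuit_element C) = circuit_element C \<bullet> circuit_element C"
    by (simp add: l1norm_def inner_vec_def)
  \<comment> \<open>The tails are a cyclic shift of the heads.\<close>
  have tails: "distinct (map (tail D) p)"
  proof -
    have eq: "u # map (head D) p = map (tail D) p @ [u]"
      using D.awalk_verts_conv'[OF cas] D.awalk_verts_conv[of u p] D.awlast_if_cas[OF cas] cas ne
      by (cases p) auto
    then have "map (head D) p = tl (map (tail D) p) @ [u]" "hd (map (tail D) p) = u"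
      using ne by (cases p; auto)+
    then show ?thesis using heads ne by (cases p) auto
  qed
  show "restrict_support (flow_space G) (fst C) = range (\<lambda>c. c *\<^sub>R circuit_element C)"
  proof (intro equalityI subsetI)
    fix x assume "x \<in> range (\<lambda>c. c *\<^sub>R circuit_element C)"
    then show "x \<in> restrict_support (flow_space G) (fst C)"
      using subspace_scale[OF subspace_flow_space flow] supp
      by (auto simp: restrict_support_def supp_def)
  next
    fix x assume "x \<in> restrict_support (flow_space G) (fst C)"
    then have x: "x \<in> flow_space G" "supp x \<subseteq> fst C" by (auto simp: restrict_support_def supp_def)
    define f where "f e = of_int (snd C e) * x $ e" for e
    have inj: "inj_on (head D) (set p)" "inj_on (tail D) (set p)"
      using heads tails by (simp_all add: distinct_map)
    \<comment> \<open>Conservation at the vertex between consecutive arcs: injectivity leaves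
      \<open>p ! i\<close> as the only arc entering it and \<open>p ! Suc i\<close> as the only one
      leaving.\<close>
    have step: "f (p ! Suc i) = f (p ! i)" if i: "Suc i < length p" for i
    proof -
      let ?v = "head D (p ! i)"
      have tv: "tail D (p ! Suc i) = ?v"
        using cas i by (rule cas_nth)
      have "?v \<in> verts G" using p i D.head_in_verts[of "p ! i"] by (metis D_simps nth_mem Suc_lessD)
      then have "0 = divergence G x ?v" using x by (simp add: flow_space_def)
      also have "\<dots> = (\<Sum>e\<in>set p. f e * of_bool (head D e = ?v)) - (\<Sum>e\<in>set p. f e * of_bool (tail D e = ?v))"
        using x(2) p by (simp add: divergence_eq f_def right_diff_distrib sum_subtractf)
      also have "(\<Sum>e\<in>set p. f e * of_bool (head D e = ?v)) = (\<Sum>e\<in>set p. if e = p ! i then f e else 0)"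
        using i by (intro sum.cong refl) (simp add: inj_on_eq_iff[OF inj(1)])
      also have "\<dots> = f (p ! i)" using i by simp
      also have "(\<Sum>e\<in>set p. f e * of_bool (tail D e = ?v)) = (\<Sum>e\<in>set p. if e = p ! Suc i then f e else 0)"
        using i by (intro sum.cong refl) (simp add: tv[symmetric] inj_on_eq_iff[OF inj(2)])
      also have "\<dots> = f (p ! Suc i)" using i by simp
      finally show ?thesis by simp
    qed
    have const: "f (p ! i) = f (p ! 0)" if "i < length p" for i
      using that by (induct i) (auto simp: step)
    have "x $ e = f (p ! 0) * circuit_element C $ e" for e
    proof (cases "e \<in> fst C")
      case True
      then obtain i where "i < length p" "e = p ! i" using p by (metis in_set_conv_nth)
      then have "f e = f (p ! 0)" using const by simp
      then show ?thesis using A_props(2)[OF True] by (auto simp: f_def val)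
    next
      case False
      then show ?thesis using x(2) A_props(3) by (auto simp: val supp_def)
    qed
    then have "x = f (p ! 0) *\<^sub>R circuit_element C" by (simp add: vec_eq_iff)
    then show "x \<in> range (\<lambda>c. c *\<^sub>R circuit_element C)" by blast
  qed
qed

text \<open>The signs of \<open>x\<close> orient its support strongly, so \<open>e\<close> lies on a
  directed circuit there.\<close>

lemma circuit_in_flow_support:
  fixes G :: "('v, 'e::finite) pre_digraph"
  assumes G: "fin_digraph G" and x: "x \<in> flow_space G" "e \<in> supp x"
  obtains C where "C \<in> oriented_circuits G" "e \<in> fst C" "conformal (circuit_element C) x"
proof -
  interpret oriented_subgraph_digraph G "sign_pattern x"
    using G x by (simp add: oriented_subgraph_digraph_def oriented_subgraph_digraph_axioms_def
        is_oriented_sign_pattern flow_space_def)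
  have "head D e \<rightarrow>\<^sup>*\<^bsub>D\<^esub> tail D e" using x by (intro reversible_of_flow) auto
  then obtain C where C: "C \<in> oriented_circuits G" "e \<in> fst C" "oriented_subgraph_le (sign_pattern x) C"
    using cycle_through x by auto
  then have "conformal (circuit_element C) x"
    using oriented_subgraph_le_sign_pattern[of x "circuit_element C"]
    by (simp add: sign_pattern_circuit_element[OF G])
  with C show ?thesis using that by blast
qed

section \<open>The Voronoi cell of the lattice of integer flows\<close>

lemma l1norm_add_conformal:
  assumes "\<And>e. \<bar>z $ e\<bar> = \<bar>x $ e\<bar> + c * \<bar>y $ e\<bar>"
  shows "l1norm z = l1norm x + c * l1norm y"
  by (simp add: l1norm_def assms sum.distrib sum_distrib_left)

lemma circuit_element_abs:
  fixes G :: "('v, 'e::finite) pre_digraph"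
  assumes "fin_digraph G" "C \<in> oriented_circuits G"
  shows "circuit_element C $ e = sgn (circuit_element C $ e)"
  using of_int_sign_pattern[of "circuit_element C" e] sign_pattern_circuit_element[OF assms]
  by (simp add: circuit_element_def)

lemma supp_circuit_element:
  fixes G :: "('v, 'e::finite) pre_digraph"
  assumes "fin_digraph G" "C \<in> oriented_circuits G"
  shows "supp (circuit_element C) = fst C"
  using sign_pattern_circuit_element[OF assms] by (metis fst_sign_pattern)

lemma circuit_element_flow_space:
  fixes G :: "('v, 'e::finite) pre_digraph"
  assumes "fin_digraph G" "C \<in> oriented_circuits G"
  shows "circuit_element C \<in> flow_space G"
  using circuit_element_flow[OF assms] by (simp add: flow_lattice_eq)

text \<open>Conformal decomposition: subtracting a suitable multiple of a circuit that agrees in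
  sign with \<open>x\<close> shrinks the support. Absolute values add without cancellation, which
  the induction step receives as additivity of \<open>l1norm\<close>.\<close>

lemma flow_circuit_induct [consumes 2, case_names zero add]:
  fixes G :: "('v, 'e::finite) pre_digraph"
  assumes G: "fin_digraph G" and x: "x \<in> flow_space G"
    and zero: "P 0"
    and add: "\<And>y C c. \<lbrakk>P y; C \<in> oriented_circuits G; c > 0;
      l1norm (y + c *\<^sub>R circuit_element C) = l1norm y + c * l1norm (circuit_element C)\<rbrakk> \<Longrightarrow>
      P (y + c *\<^sub>R circuit_element C)"
  shows "P x"
  using x
proof (induct "card (supp x)" arbitrary: x rule: less_induct)
  case less
  show ?case
  proof (cases "x = 0")
    case False
    then obtain e where "e \<in> supp x" by (auto simp: supp_def vec_eq_iff)
    then obtain C where C: "C \<in> oriented_circuits G" "e \<in> fst C" "conformal (circuit_element C) x"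
      using circuit_in_flow_support[OF G less.prems] by blast
    let ?u = "circuit_element C"
    \<comment> \<open>The largest multiple that reverses no sign; where the minimum is attained, the
      coordinate becomes \<open>0\<close>.\<close>
    define c where "c = Min ((\<lambda>a. \<bar>x $ a\<bar>) ` fst C)"
    have u: "?u $ a = (if a \<in> fst C then sgn (x $ a) else 0)" for a
      using C(3) circuit_element_abs[OF G C(1), of a] supp_circuit_element[OF G C(1)]
      by (auto simp: conformal_def supp_def)
    have nz: "x $ a \<noteq> 0" if "a \<in> fst C" for a
    proof -
      have "?u $ a \<noteq> 0" using that supp_circuit_element[OF G C(1)] by (auto simp: supp_def)
      then show ?thesis using u[of a] that by (auto simp: sgn_zero_iff)
    qed
    have "c \<in> (\<lambda>a. \<bar>x $ a\<bar>) ` fst C" unfolding c_def using C(2) by (intro Min_in) auto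
    then obtain b where b: "b \<in> fst C" "c = \<bar>x $ b\<bar>" by auto
    have c: "c > 0" using b nz by simp
    have cle: "c \<le> \<bar>x $ a\<bar>" if "a \<in> fst C" for a
      unfolding c_def using that by (intro Min_le) auto
    define y where "y = x - c *\<^sub>R ?u"
    have x_eq: "x = y + c *\<^sub>R ?u" by (simp add: y_def)
    have y_C: "y $ a = sgn (x $ a) * (\<bar>x $ a\<bar> - c)" if "a \<in> fst C" for a
      using that by (simp add: y_def u right_diff_distrib sgn_mult_abs)
    have y_nC: "y $ a = x $ a" if "a \<notin> fst C" for a
      using that by (simp add: y_def u)
    have "supp y \<subseteq> supp x"
    proof
      fix a assume "a \<in> supp y" then show "a \<in> supp x"
        using nz[of a] y_nC[of a] by (cases "a \<in> fst C") (auto simp: supp_def)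
    qed
    moreover have "b \<in> supp x" "b \<notin> supp y" using b nz y_C by (auto simp: supp_def)
    ultimately have "supp y \<subset> supp x" by auto
    then have "card (supp y) < card (supp x)" by (intro psubset_card_mono) auto
    moreover have "y \<in> flow_space G" unfolding y_def
      by (intro subspace_diff subspace_scale subspace_flow_space less.prems
          circuit_element_flow_space[OF G C(1)])
    ultimately have "P y" by (rule less.hyps)
    moreover have "\<bar>x $ a\<bar> = \<bar>y $ a\<bar> + c * \<bar>?u $ a\<bar>" for a
    proof (cases "a \<in> fst C")
      case True
      then have "\<bar>y $ a\<bar> = \<bar>x $ a\<bar> - c" "\<bar>?u $ a\<bar> = 1"
        using cle[OF True] nz[OF True] by (simp_all add: y_C u abs_mult)
      then show ?thesis by simp
    qed (simp add: y_nC u)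
    then have "l1norm x = l1norm y + c * l1norm ?u" by (rule l1norm_add_conformal)
    ultimately show ?thesis using add[of y C c] C(1) c x_eq by simp
  qed (simp add: zero)
qed

lemma flow_space_eq_span:
  fixes G :: "('v, 'e::finite) pre_digraph"
  assumes G: "fin_digraph G"
  shows "flow_space G = span (flow_lattice G)"
proof (rule antisym)
  show "span (flow_lattice G) \<subseteq> flow_space G"
    by (intro span_minimal subspace_flow_space) (auto simp: flow_lattice_eq)
  show "flow_space G \<subseteq> span (flow_lattice G)"
  proof
    fix x assume "x \<in> flow_space G"
    with G show "x \<in> span (flow_lattice G)"
    proof (induct rule: flow_circuit_induct)
      case (add y C c)
      then show ?case
        using span_add span_scale[OF span_base[OF circuit_element_flow[OF G]]] by blast
    qed (rule span_zero)
  qed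
qed

lemma l1norm_le_inner_integral:
  fixes v :: "real^'e::finite"
  assumes "\<And>e. v $ e \<in> \<int>"
  shows "l1norm v \<le> v \<bullet> v"
proof -
  have "\<bar>v $ e\<bar> \<le> v $ e * v $ e" for e
  proof -
    obtain n where n: "v $ e = of_int n" using assms[of e] by (auto elim: Ints_cases)
    have "\<bar>n\<bar> \<le> \<bar>n\<bar> * \<bar>n\<bar>" 
      using mult_left_mono[of 1 "\<bar>n\<bar>" "\<bar>n\<bar>"] by (cases "n = 0") auto
    then have "\<bar>n\<bar> \<le> n * n" by simp
    then have "real_of_int \<bar>n\<bar> \<le> real_of_int (n * n)" by (rule of_int_le_iff[THEN iffD2])
    then show ?thesis by (simp add: n)
  qed
  then show ?thesis by (auto simp: l1norm_def inner_vec_def intro: sum_mono)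
qed

text \<open>The Voronoi inequality of a circuit element is its zonotope inequality, as squared norm
  and \<open>l1norm\<close> agree; conformal decomposition extends it to all flows. Conversely,
  \<open>l1norm v \<le> v \<bullet> v\<close> for integral \<open>v\<close>.\<close>

lemma voronoi_cell_eq_zonotope:
  fixes G :: "('v, 'e::finite) pre_digraph"
  assumes G: "fin_digraph G"
  shows "voronoi_cell G = zonotope (flow_space G)"
proof -
  have expand: "x \<bullet> x \<le> (x - v) \<bullet> (x - v) \<longleftrightarrow> 2 * (x \<bullet> v) \<le> v \<bullet> v" for x v :: "real^'e"
    by (simp add: inner_diff_left inner_diff_right inner_commute)
  show ?thesis
  proof (intro equalityI subsetI)
    fix x assume x: "x \<in> voronoi_cell G"
    have "2 * (x \<bullet> w) \<le> l1norm w" if "w \<in> flow_space G" for w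
      using G that
    proof (induct rule: flow_circuit_induct)
      case zero
      show ?case by (simp add: l1norm_def)
    next
      case (add y C c)
      have "2 * (x \<bullet> circuit_element C) \<le> l1norm (circuit_element C)"
        using x circuit_element_flow[OF G add(2)] l1norm_circuit_element[OF G add(2)]
        by (auto simp: voronoi_cell_def expand)
      then have "c * (2 * (x \<bullet> circuit_element C)) \<le> c * l1norm (circuit_element C)"
        using add(3) by (intro mult_left_mono) auto
      with add(1) show ?case unfolding add(4) by (simp add: inner_add_right)
    qed
    then show "x \<in> zonotope (flow_space G)"
      using x by (simp add: zonotope_def voronoi_cell_def flow_space_eq_span[OF G])
  next
    fix x assume x: "x \<in> zonotope (flow_space G)"
    have "2 * (x \<bullet> v) \<le> v \<bullet> v" if "v \<in> flow_lattice G" for v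
    proof -
      have "2 * (x \<bullet> v) \<le> l1norm v" using x that by (auto simp: zonotope_def flow_lattice_eq)
      also have "\<dots> \<le> v \<bullet> v" using that by (intro l1norm_le_inner_integral) (auto simp: flow_lattice_eq)
      finally show ?thesis .
    qed
    then show "x \<in> voronoi_cell G"
      using x by (simp add: voronoi_cell_def expand zonotope_def flow_space_eq_span[OF G])
  qed
qed

section \<open>Faces of the cell and the isomorphism with oriented subgraphs\<close>

lemma voronoi_faces_eq:
  fixes G :: "('v, 'e::finite) pre_digraph"
  assumes G: "fin_digraph G"
  shows "voronoi_faces G = zono_face (flow_space G) ` flow_space G"
  using face_of_zonotope_iff[OF subspace_flow_space, of _ G]
  by (auto simp: voronoi_faces_def voronoi_cell_eq_zonotope[OF G])

lemma circuit_face_eq: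
  fixes G :: "('v, 'e::finite) pre_digraph"
  assumes G: "fin_digraph G" and C: "C \<in> oriented_circuits G"
  shows "circuit_face G C = zono_face (flow_space G) (circuit_element C)"
  unfolding circuit_face_def zono_face_def voronoi_cell_eq_zonotope[OF G]
    l1norm_circuit_element[OF G C] by auto

lemma sign_pattern_eq_iff: "sign_pattern u = sign_pattern w \<longleftrightarrow> conformal u w \<and> conformal w u"
proof
  assume "sign_pattern u = sign_pattern w"
  then have "sgn (u $ e) = sgn (w $ e)" for e by (metis of_int_sign_pattern)
  then show "conformal u w \<and> conformal w u" by (auto simp: conformal_def)
next
  assume c: "conformal u w \<and> conformal w u"
  have "sgn (u $ e) = sgn (w $ e)" for e
    using c unfolding conformal_def by metis
  then have s: "of_int (snd (sign_pattern u) e) = (of_int (snd (sign_pattern w) e) :: real)" for e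
    by (simp add: of_int_sign_pattern)
  have "supp u = supp w" unfolding supp_def using c by (auto simp: conformal_def sgn_zero_iff)
  with s show "sign_pattern u = sign_pattern w" by (intro prod_eqI ext) auto
qed

lemma zono_face_eq_iff:
  assumes "subspace W" "u \<in> W" "w \<in> W"
  shows "zono_face W u = zono_face W w \<longleftrightarrow> sign_pattern u = sign_pattern w"
  using zono_face_subset_iff[OF assms] zono_face_subset_iff[OF assms(1,3,2)]
  by (auto simp: sign_pattern_eq_iff)

lemma genus_spanning_sub:
  fixes G :: "('v, 'e::finite) pre_digraph"
  assumes G: "fin_digraph G" and H: "H \<subseteq> arcs G"
  shows "genus (spanning_sub G H) = dim (restrict_support (flow_space G) H)"
proof -
  interpret fin_digraph G by (rule G)
  have "fin_digraph (spanning_sub G H)"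
    using H by unfold_locales (auto simp: spanning_sub_def)
  then show ?thesis
    by (simp add: genus_def restrict_support_flow_space[OF H] flow_space_eq_span)
qed

text \<open>A face is sent to the sign pattern of any flow exposing it; the face determines these
  signs, so the choice does not matter. The remaining conditions are facts about the
  zonotope.\<close>

lemma amini_isomorphism_exists:
  fixes G :: "('v, 'e::finite) pre_digraph"
  assumes G: "fin_digraph G"
  shows "\<exists>\<phi>. amini_isomorphism G \<phi>"
proof -
  let ?W = "flow_space G"
  note W = subspace_flow_space[of G]
  define \<phi> where "\<phi> F = sign_pattern (inv_into ?W (zono_face ?W) F)" for F
  have \<phi>: "\<phi> (zono_face ?W w) = sign_pattern w" if "w \<in> ?W" for w
  proof -
    let ?u = "inv_into ?W (zono_face ?W) (zono_face ?W w)"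
    have "?u \<in> ?W" "zono_face ?W ?u = zono_face ?W w"
      using inv_into_into[OF imageI[OF that]] f_inv_into_f[OF imageI[OF that]] by auto
    then show ?thesis unfolding \<phi>_def using zono_face_eq_iff[OF W] that by blast
  qed
  have "bij_betw \<phi> (voronoi_faces G) (strongly_oriented_subgraphs G)"
    unfolding bij_betw_def voronoi_faces_eq[OF G] strongly_oriented_subgraphs_eq[OF G] image_image
    using zono_face_eq_iff[OF W] by (auto simp: \<phi> inj_on_def)
  moreover have "\<forall>F\<in>voronoi_faces G. \<forall>F'\<in>voronoi_faces G.
      F \<subseteq> F' \<longleftrightarrow> oriented_subgraph_le (\<phi> F) (\<phi> F')"
    by (auto simp: voronoi_faces_eq[OF G] \<phi> oriented_subgraph_le_sign_pattern zono_face_subset_iff[OF W])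
  moreover have "\<forall>F\<in>voronoi_faces G.
      aff_dim (voronoi_cell G) - aff_dim F = int (genus (spanning_sub G (fst (\<phi> F))))"
  proof -
    have "supp w \<subseteq> arcs G" if "w \<in> ?W" for w using that by (simp add: flow_space_def)
    then show ?thesis
      by (auto simp: voronoi_faces_eq[OF G] \<phi> genus_spanning_sub[OF G] voronoi_cell_eq_zonotope[OF G]
          aff_dim_zonotope[OF W] aff_dim_zono_face[OF W])
  qed
  moreover have "\<forall>C\<in>oriented_circuits G. circuit_face G C \<in> voronoi_faces G \<and> \<phi> (circuit_face G C) = C"
    by (simp add: circuit_face_eq[OF G] voronoi_faces_eq[OF G] \<phi> circuit_element_flow_space[OF G]
        sign_pattern_circuit_element[OF G])
  ultimately show ?thesis unfolding amini_isomorphism_def by blast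
qed

text \<open>A nonzero coordinate of \<open>u\<close> lies on a circuit conformal to
  \<open>u\<close>, and this circuit transports the sign to \<open>w\<close>.\<close>

lemma conformal_if_circuits:
  fixes G :: "('v, 'e::finite) pre_digraph"
  assumes G: "fin_digraph G" and u: "u \<in> flow_space G"
    and "\<And>C. C \<in> oriented_circuits G \<Longrightarrow> conformal (circuit_element C) u \<Longrightarrow> conformal (circuit_element C) w"
  shows "conformal u w"
  unfolding conformal_def
proof (intro allI impI)
  fix e assume "u $ e \<noteq> 0"
  then obtain C where C: "C \<in> oriented_circuits G" "e \<in> fst C" "conformal (circuit_element C) u"
    using circuit_in_flow_support[OF G u] by (auto simp: supp_def)
  then have "conformal (circuit_element C) w" "circuit_element C $ e \<noteq> 0"
    using assms(3) supp_circuit_element[OF G C(1)] by (auto simp: supp_def)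
  with C(3) show "sgn (u $ e) = sgn (w $ e)" by (auto simp: conformal_def)
qed

text \<open>\<open>Amini\<close> is chosen among all such isomorphisms, so its values must be
  forced. The circuits conformal to the pattern \<open>\<phi> ?F\<close> are those whose faces
  contain \<open>?F\<close>, and these circuits determine the signs of a flow.\<close>

lemma amini_isomorphism_unique:
  fixes G :: "('v, 'e::finite) pre_digraph"
  assumes G: "fin_digraph G" and \<phi>: "amini_isomorphism G \<phi>" and w: "w \<in> flow_space G"
  shows "\<phi> (zono_face (flow_space G) w) = sign_pattern w"
proof -
  let ?F = "zono_face (flow_space G) w"
  note W = subspace_flow_space[of G]
  have F: "?F \<in> voronoi_faces G" using w by (simp add: voronoi_faces_eq[OF G])
  then have "\<phi> ?F \<in> strongly_oriented_subgraphs G"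
    using \<phi> by (auto simp: amini_isomorphism_def bij_betw_def)
  then obtain u where u: "u \<in> flow_space G" "\<phi> ?F = sign_pattern u"
    by (auto simp: strongly_oriented_subgraphs_eq[OF G])
  have "conformal (circuit_element C) w \<longleftrightarrow> conformal (circuit_element C) u"
    if C: "C \<in> oriented_circuits G" for C
  proof -
    have "conformal (circuit_element C) w \<longleftrightarrow> ?F \<subseteq> circuit_face G C"
      using C w by (simp add: circuit_face_eq[OF G] zono_face_subset_iff[OF W] circuit_element_flow_space[OF G])
    also have "\<dots> \<longleftrightarrow> oriented_subgraph_le (sign_pattern u) C"
      using \<phi> F C u(2) by (auto simp: amini_isomorphism_def)
    also have "\<dots> \<longleftrightarrow> conformal (circuit_element C) u"
      using oriented_subgraph_le_sign_pattern[of u "circuit_element C"]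
      by (simp add: sign_pattern_circuit_element[OF G C])
    finally show ?thesis .
  qed
  then have "conformal u w" "conformal w u"
    using conformal_if_circuits[OF G] u(1) w by blast+
  then show ?thesis using u(2) by (simp add: sign_pattern_eq_iff)
qed

lemma Amini_inv_sign_pattern:
  fixes G :: "('v, 'e::finite) pre_digraph"
  assumes G: "fin_digraph G" and w: "w \<in> flow_space G"
  shows "Amini_inv G (sign_pattern w) = zono_face (flow_space G) w"
proof -
  have iso: "amini_isomorphism G (Amini G)"
    unfolding Amini_def using amini_isomorphism_exists[OF G] by (rule someI_ex)
  then have "inj_on (Amini G) (voronoi_faces G)" by (simp add: amini_isomorphism_def bij_betw_def)
  then show ?thesis unfolding Amini_inv_def
    using w amini_isomorphism_unique[OF G iso w]
    by (intro inv_into_f_eq) (simp_all add: voronoi_faces_eq[OF G])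
qed

section \<open>Parallel classes\<close>

text \<open>\<open>u\<close> is constant on its own face, hence on a parallel one, and constancy
  there means \<open>supp u \<subseteq> supp w\<close>; the roles are symmetric.\<close>

lemma zono_face_parallel_iff:
  assumes W: "subspace W" "u \<in> W" "w \<in> W"
  shows "affine_parallel (affine hull zono_face W u) (affine hull zono_face W w) \<longleftrightarrow> supp u = supp w"
proof
  assume par: "affine_parallel (affine hull zono_face W u) (affine hull zono_face W w)"
  then have par': "affine_parallel (affine hull zono_face W w) (affine hull zono_face W u)"
    by (rule affine_parallel_commute)
  show "supp u = supp w"
    using affine_parallel_constant[OF par, of u] affine_parallel_constant[OF par', of w] W
    by (simp add: constant_on_zono_face_iff)
qed (rule zono_face_parallel[OF W])

text \<open>Parallel classes are the fibres of the support. For \<open>Q\<close> stand the flows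
  exposing edges and, later, those exposing facets.\<close>

lemma bij_betw_parallel_classes:
  assumes W: "subspace W" and Q: "Q \<subseteq> W"
  shows "bij_betw (\<lambda>H. zono_face W ` {w \<in> Q. supp w = H}) (supp ` Q)
    (parallel_classes (zono_face W ` Q))"
proof -
  let ?f = "\<lambda>H. zono_face W ` {w \<in> Q. supp w = H}"
  let ?r = "{(F, F'). F \<in> zono_face W ` Q \<and> F' \<in> zono_face W ` Q \<and>
    affine_parallel (affine hull F) (affine hull F')}"
  have par: "affine_parallel (affine hull zono_face W u) (affine hull zono_face W w) \<longleftrightarrow> supp u = supp w"
    if "u \<in> Q" "w \<in> Q" for u w
    using zono_face_parallel_iff[OF W] Q that by blast
  have supp_eq: "supp u = supp w" if "u \<in> Q" "w \<in> Q" "zono_face W u = zono_face W w" for u w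
    using par[OF that(1,2)] par[OF that(1,1)] that(3) by simp
  have cls: "?r `` {zono_face W w} = ?f (supp w)" if "w \<in> Q" for w
    using par that by auto
  have "inj_on ?f (supp ` Q)"
  proof (rule inj_onI)
    fix H H' assume H: "H \<in> supp ` Q" and "H' \<in> supp ` Q" and eq: "?f H = ?f H'"
    from H obtain u where u: "u \<in> Q" "supp u = H" by auto
    then have "zono_face W u \<in> ?f H'" unfolding eq[symmetric] by blast
    then obtain w where "w \<in> Q" "supp w = H'" "zono_face W u = zono_face W w" by auto
    then show "H = H'" using supp_eq u by blast
  qed
  moreover have "?f ` supp ` Q = parallel_classes (zono_face W ` Q)"
  proof -
    have "parallel_classes (zono_face W ` Q) = (\<lambda>w. ?r `` {zono_face W w}) ` Q"
      unfolding parallel_classes_def quotient_def by auto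
    also have "\<dots> = (\<lambda>w. ?f (supp w)) ` Q" using cls by (intro image_cong refl)
    finally show ?thesis by (simp add: image_image)
  qed
  ultimately show ?thesis unfolding bij_betw_def by blast
qed

section \<open>Vanishing coordinates and 3-connectedness\<close>

lemma dim_vanishing_coordinate:
  fixes U :: "(real^'e::finite) set"
  assumes U: "subspace U" and v: "v \<in> U" "v $ e \<noteq> 0"
  shows "dim U = dim {u \<in> U. u $ e = 0} + 1"
proof -
  let ?R = "{u \<in> U. u $ e = 0}"
  have R: "subspace ?R" using U by (auto simp: subspace_def)
  then have "v \<notin> span ?R" using v by (simp add: span_eq_iff[THEN iffD2])
  then have "dim (insert v ?R) = dim ?R + 1" by (simp add: dim_insert)
  moreover have "span (insert v ?R) = U"
  proof (rule antisym)
    show "span (insert v ?R) \<subseteq> U" using U v by (intro span_minimal) auto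
    show "U \<subseteq> span (insert v ?R)"
    proof
      fix u assume u: "u \<in> U"
      let ?c = "u $ e / v $ e"
      have "u - ?c *\<^sub>R v \<in> ?R" using u v U by (simp add: subspace_diff subspace_scale)
      then have "(u - ?c *\<^sub>R v) + ?c *\<^sub>R v \<in> span (insert v ?R)"
        by (intro span_add span_scale) (auto intro: span_base)
      then show "u \<in> span (insert v ?R)" by simp
    qed
  qed
  ultimately show ?thesis by (metis dim_span)
qed

text \<open>On a line \<open>u + t v\<close> with \<open>v\<close> nonzero at the new coordinate,
  only finitely many \<open>t\<close> are bad.\<close>

lemma subspace_avoids_coordinate_hyperplanes:
  fixes U :: "(real^'e::finite) set"
  assumes U: "subspace U" and "finite T" "\<And>f. f \<in> T \<Longrightarrow> \<exists>u\<in>U. u $ f \<noteq> 0"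
  shows "\<exists>u\<in>U. \<forall>f\<in>T. u $ f \<noteq> 0"
  using assms(2,3)
proof (induct T)
  case empty
  show ?case using subspace_0[OF U] by auto
next
  case (insert f T)
  then obtain u v where u: "u \<in> U" "\<forall>g\<in>T. u $ g \<noteq> 0" and v: "v \<in> U" "v $ f \<noteq> 0"
    by (metis insertCI)
  \<comment> \<open>One value to avoid for each coordinate. Where \<open>v\<close> vanishes
    \<open>u\<close> does not, so any \<open>t\<close> works; the quotient is then
    \<open>0\<close>.\<close>
  have "finite ((\<lambda>g. - u $ g / v $ g) ` insert f T)" using insert by simp
  then obtain t where t: "t \<notin> (\<lambda>g. - u $ g / v $ g) ` insert f T"
    using ex_new_if_finite[OF infinite_UNIV_char_0] by blast
  have "(u + t *\<^sub>R v) $ g \<noteq> 0" if "g \<in> insert f T" for g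
  proof (cases "v $ g = 0")
    case True
    then show ?thesis using that u v by auto
  next
    case False
    have "t \<noteq> - u $ g / v $ g" using t that by auto
    then show ?thesis using False by (auto simp: field_simps add_eq_0_iff)
  qed
  moreover have "u + t *\<^sub>R v \<in> U" using u v U by (intro subspace_add subspace_scale)
  ultimately show ?case by blast
qed

text \<open>Undirected counterpart of \<open>unit_flow_of_reachable\<close>: an edge crossed against
  the reference direction contributes \<open>-1\<close>.\<close>

lemma unit_flow_of_connected:
  fixes G :: "('v, 'e::finite) pre_digraph"
  assumes H: "H \<subseteq> arcs G" and "Digraph_Component.connected (spanning_sub G H)"
    and "u \<in> verts G" "v \<in> verts G"
  shows "\<exists>x::real^'e. supp x \<subseteq> H \<and> (\<forall>w. divergence G x w = of_bool (v = w) - of_bool (u = w))"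
proof -
  have "(u, v) \<in> rtrancl_on (verts G) (symcl (arcs_ends (spanning_sub G H)))"
    using assms by (simp add: connected_conv) (simp add: spanning_sub_def)
  then show ?thesis
  proof (induct rule: rtrancl_on_induct)
    case base
    show ?case by (rule exI[of _ 0]) (simp add: divergence_zero)
  next
    case (step v w)
    then obtain x :: "real^'e" where x: "supp x \<subseteq> H"
      "\<forall>w. divergence G x w = of_bool (v = w) - of_bool (u = w)" by blast
    obtain e where e: "e \<in> H" "v = tail G e \<and> w = head G e \<or> v = head G e \<and> w = tail G e"
      using step(2) by (auto simp: symcl_def arcs_ends_conv spanning_sub_def)
    define y where "y = x + axis e (if v = tail G e \<and> w = head G e then 1 else - 1)"
    have "supp y \<subseteq> H" using x(1) e(1) by (auto simp: y_def supp_def axis_def)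
    moreover have "divergence G y z = of_bool (w = z) - of_bool (u = z)" for z
      using x(2) e H by (auto simp: y_def divergence_add divergence_axis subset_iff)
    ultimately show ?case by blast
  qed
qed

text \<open>After deletion of \<open>e\<close> and \<open>f\<close> a unit can still be sent from
  the head of \<open>e\<close> to its tail; \<open>e\<close> closes it to a flow. The case
  \<open>f = e\<close> deletes only \<open>e\<close>.\<close>

lemma three_connected_flow:
  fixes G :: "('v, 'e::finite) pre_digraph"
  assumes G: "fin_digraph G" and tc: "three_connected G" and e: "e \<in> arcs G"
  shows "\<exists>x\<in>flow_space G. x $ e \<noteq> 0 \<and> (f \<noteq> e \<longrightarrow> x $ f = 0)"
proof -
  interpret fin_digraph G by (rule G)
  \<comment> \<open>\<open>f\<close> may lie outside the graph, while \<open>three_connected\<close>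
    speaks of sets of arcs.\<close>
  let ?H = "arcs G - {e, f} \<inter> arcs G"
  have "card ({e, f} \<inter> arcs G) \<le> card {e, f}" by (intro card_mono) auto
  also have "\<dots> \<le> 2" by (auto simp: card_insert_if)
  finally have "Digraph_Component.connected (spanning_sub G ?H)"
    using tc unfolding three_connected_def by blast
  then obtain x :: "real^'e" where x: "supp x \<subseteq> ?H"
    "\<And>w. divergence G x w = of_bool (tail G e = w) - of_bool (head G e = w)"
    using unit_flow_of_connected[of ?H G "head G e" "tail G e"] e by auto
  have "supp (x + axis e 1) \<subseteq> arcs G" using x(1) e by (auto simp: supp_def axis_def)
  then have "x + axis e 1 \<in> flow_space G"
    using e by (simp add: flow_space_def divergence_add divergence_axis x(2))
  moreover have "(x + axis e 1) $ e \<noteq> 0" "f \<noteq> e \<longrightarrow> (x + axis e 1) $ f = 0"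
  proof -
    have "e \<notin> supp x" using x(1) e by blast
    then show "(x + axis e 1) $ e \<noteq> 0" by (simp add: supp_def)
    have "f \<notin> supp x" using x(1) by blast
    then show "f \<noteq> e \<longrightarrow> (x + axis e 1) $ f = 0" by (auto simp: supp_def axis_def)
  qed
  ultimately show ?thesis by blast
qed

text \<open>Every other coordinate is nonzero for some flow avoiding \<open>e\<close>, so a generic
  such flow is nonzero on all of them.\<close>

lemma three_connected_nowhere_zero_flow:
  fixes G :: "('v, 'e::finite) pre_digraph"
  assumes G: "fin_digraph G" and tc: "three_connected G" and e: "e \<in> arcs G"
  shows "\<exists>w\<in>flow_space G. supp w = arcs G - {e}"
proof -
  let ?U = "{u \<in> flow_space G. u $ e = 0}"
  have "subspace ?U" using subspace_flow_space[of G] by (auto simp: subspace_def)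
  moreover have "\<exists>u\<in>?U. u $ f \<noteq> 0" if "f \<in> arcs G - {e}" for f
    using three_connected_flow[OF G tc, of f e] that by auto
  ultimately obtain w where "w \<in> ?U" "\<forall>f\<in>arcs G - {e}. w $ f \<noteq> 0"
    using subspace_avoids_coordinate_hyperplanes[of ?U "arcs G - {e}"] by auto
  then show ?thesis by (intro bexI[of _ w]) (auto simp: flow_space_def supp_def)
qed

text \<open>Vanishing on one arc \<open>e\<close> costs one dimension of flows, and vanishing on a
  second arc \<open>f\<close> another one, since some flow avoids \<open>e\<close> but uses
  \<open>f\<close>. So codimension one means that exactly one arc is missing.\<close>

lemma aff_dim_zono_face_eq_1_iff:
  fixes G :: "('v, 'e::finite) pre_digraph"
  assumes G: "fin_digraph G" and tc: "three_connected G" and w: "w \<in> flow_space G"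
  shows "aff_dim (zono_face (flow_space G) w) = 1 \<longleftrightarrow> (\<exists>e\<in>arcs G. supp w = arcs G - {e})"
proof -
  let ?W = "flow_space G" and ?R = "restrict_support (flow_space G) (supp w)"
  note W = subspace_flow_space[of G]
  define R where "R e = {u \<in> ?W. u $ e = 0}" for e
  have R: "subspace (R e)" for e using W unfolding R_def by (auto simp: subspace_def)
  have dimR: "dim ?W = dim (R e) + 1" if e: "e \<in> arcs G" for e
  proof -
    obtain x where "x \<in> ?W" "x $ e \<noteq> 0" using three_connected_flow[OF G tc e] by blast
    then show ?thesis unfolding R_def by (rule dim_vanishing_coordinate[OF W])
  qed
  have arcs: "supp u \<subseteq> arcs G" if "u \<in> ?W" for u using that by (simp add: flow_space_def)
  have dim: "aff_dim (zono_face ?W w) = int (dim ?W) - int (dim ?R)"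
    by (rule aff_dim_zono_face[OF W w])
  show ?thesis
  proof
    assume "\<exists>e\<in>arcs G. supp w = arcs G - {e}"
    then obtain e where e: "e \<in> arcs G" "supp w = arcs G - {e}" by blast
    have "?R = R e" using arcs e unfolding R_def restrict_support_def supp_def by blast
    then show "aff_dim (zono_face ?W w) = 1" using dim dimR[OF e(1)] by simp
  next
    assume "aff_dim (zono_face ?W w) = 1"
    then have codim: "dim ?W = dim ?R + 1" using dim by linarith
    \<comment> \<open>Full support would make the face a vertex.\<close>
    have "supp w \<noteq> arcs G"
    proof
      assume "supp w = arcs G"
      then have "?R = ?W" using arcs unfolding restrict_support_def supp_def by blast
      then show False using codim by simp
    qed
    then obtain e where e: "e \<in> arcs G" "e \<notin> supp w" using arcs[OF w] by blast
    have "f = e" if f: "f \<in> arcs G" "f \<notin> supp w" for f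
    proof (rule ccontr)
      assume "f \<noteq> e"
      then obtain x where "x \<in> R e" "x $ f \<noteq> 0"
        using three_connected_flow[OF G tc f(1), of e] unfolding R_def by blast
      then have "dim (R e) = dim {u \<in> R e. u $ f = 0} + 1"
        by (rule dim_vanishing_coordinate[OF R])
      moreover have "dim ?R \<le> dim {u \<in> R e. u $ f = 0}"
        using e f by (intro dim_subset) (auto simp: R_def restrict_support_def)
      ultimately show False using codim dimR[OF e(1)] by linarith
    qed
    then have "supp w = arcs G - {e}" using arcs[OF w] e by blast
    then show "\<exists>e\<in>arcs G. supp w = arcs G - {e}" using e(1) by blast
  qed
qed

section \<open>Circuits, facets and extension of signs\<close>

text \<open>A circuit carries only multiples of its element. Conversely, a circuit conformal to
  \<open>w\<close> spans the one-dimensional space, so \<open>w\<close> is a multiple of it, and a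
  positive one because the signs agree.\<close>

lemma dim_restrict_support_eq_1_iff:
  fixes G :: "('v, 'e::finite) pre_digraph"
  assumes G: "fin_digraph G" and w: "w \<in> flow_space G"
  shows "dim (restrict_support (flow_space G) (supp w)) = 1 \<longleftrightarrow> sign_pattern w \<in> oriented_circuits G"
proof -
  let ?R = "restrict_support (flow_space G) (supp w)"
  have span: "range (\<lambda>c. c *\<^sub>R u) = span {u}" for u :: "real^'e" by (simp add: span_singleton)
  have nz: "circuit_element C \<noteq> 0" if "C \<in> oriented_circuits G" for C
    using oriented_circuit_nonempty[OF G that] supp_circuit_element[OF G that] by auto
  show ?thesis
  proof
    assume C: "sign_pattern w \<in> oriented_circuits G"
    have "?R = span {circuit_element (sign_pattern w)}"
      using restrict_support_circuit[OF G C] span by simp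
    then show "dim ?R = 1" using nz[OF C] by (simp add: dim_insert)
  next
    assume one: "dim ?R = 1"
    have R: "subspace ?R" using subspace_flow_space[of G]
      by (auto simp: restrict_support_def subspace_def)
    have "w \<noteq> 0"
    proof
      assume "w = 0"
      then have "supp w = {}" by simp
      then have "?R \<subseteq> {0}" by (auto simp: restrict_support_def vec_eq_iff)
      then show False using one by (metis dim_eq_0 zero_neq_one)
    qed
    then obtain e where "e \<in> supp w" by (auto simp: supp_def vec_eq_iff)
    then obtain C where C: "C \<in> oriented_circuits G" "e \<in> fst C" "conformal (circuit_element C) w"
      using circuit_in_flow_support[OF G w] by blast
    have "circuit_element C \<in> ?R"
      using C circuit_element_flow_space[OF G C(1)]
      unfolding restrict_support_def conformal_def supp_def by (auto simp: sgn_zero_iff)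
    then have "span {circuit_element C} \<subseteq> ?R" using R by (intro span_minimal) auto
    moreover have "dim ?R \<le> dim (span {circuit_element C})"
      using one nz[OF C(1)] by (simp add: dim_insert)
    ultimately have "span {circuit_element C} = ?R"
      using R by (intro subspace_dim_equal) auto
    moreover have "w \<in> ?R" using w by (auto simp: restrict_support_def supp_def)
    ultimately obtain k where k: "w = k *\<^sub>R circuit_element C" using span by blast
    have "circuit_element C $ e \<noteq> 0" using C(2) supp_circuit_element[OF G C(1)] by (auto simp: supp_def)
    with C(3) have "sgn (circuit_element C $ e) = sgn k * sgn (circuit_element C $ e)"
      by (auto simp: conformal_def k sgn_mult)
    then have "sgn k = 1" using \<open>circuit_element C $ e \<noteq> 0\<close> by (simp add: sgn_zero_iff)
    then have "conformal w (circuit_element C)" by (simp add: conformal_def k sgn_mult)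
    then have "sign_pattern w = C"
      using C(3) sign_pattern_circuit_element[OF G C(1)] by (metis sign_pattern_eq_iff)
    with C(1) show "sign_pattern w \<in> oriented_circuits G" by simp
  qed
qed

lemma supp_minus [simp]: "supp (- x) = supp x"
  by (auto simp: supp_def)

text \<open>The dimension criterion sees only the support, which a flow shares with its negative;
  this replaces the reversal of a walk.\<close>

lemma opposite_oriented_circuit:
  fixes G :: "('v, 'e::finite) pre_digraph"
  assumes G: "fin_digraph G" and C: "C \<in> oriented_circuits G"
  shows "opposite C \<in> oriented_circuits G"
proof -
  let ?c = "circuit_element C"
  have c: "sign_pattern ?c = C" "?c \<in> flow_space G" "- ?c \<in> flow_space G"
    using sign_pattern_circuit_element[OF G C] circuit_element_flow_space[OF G C]
      subspace_neg[OF subspace_flow_space] by auto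
  have "opposite C = opposite (sign_pattern ?c)" by (simp only: c)
  also have "\<dots> = sign_pattern (- ?c)"
    by (auto simp: opposite_def sign_pattern_def supp_def)
  also have "\<dots> \<in> oriented_circuits G"
    using dim_restrict_support_eq_1_iff[OF G c(3)] dim_restrict_support_eq_1_iff[OF G c(2)] c(1) C by simp
  finally show ?thesis .
qed

lemma fst_opposite [simp]: "fst (opposite C) = fst C"
  by (simp add: opposite_def split: prod.splits)

text \<open>Adding a large multiple of \<open>c\<close> to \<open>w\<close> imposes the signs of
  \<open>c\<close> without changing the support.\<close>

lemma conformal_extension:
  fixes G :: "('v, 'e::finite) pre_digraph"
  assumes "c \<in> flow_space G" "w \<in> flow_space G" "supp c \<subseteq> supp w"
  shows "\<exists>u\<in>flow_space G. supp u = supp w \<and> conformal c u"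
proof -
  \<comment> \<open>The summand \<open>1\<close> makes \<open>m\<close> exceed every ratio strictly;
    coordinates with \<open>c $ e = 0\<close> enter the maximum as \<open>0\<close>.\<close>
  define m where "m = Max (range (\<lambda>e. \<bar>w $ e\<bar> / \<bar>c $ e\<bar>)) + 1"
  have m: "\<bar>w $ e\<bar> < m * \<bar>c $ e\<bar>" if "c $ e \<noteq> 0" for e
  proof -
    have "\<bar>w $ e\<bar> / \<bar>c $ e\<bar> \<le> Max (range (\<lambda>e. \<bar>w $ e\<bar> / \<bar>c $ e\<bar>))" by (rule Max_ge) auto
    then have "\<bar>w $ e\<bar> / \<bar>c $ e\<bar> < m" unfolding m_def by linarith
    then show ?thesis using that by (simp add: pos_divide_less_eq)
  qed
  define u where "u = w + m *\<^sub>R c"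
  have sgn: "sgn (u $ e) = sgn (c $ e)" if "c $ e \<noteq> 0" for e
    using m[OF that] that by (cases "c $ e > 0") (auto simp: u_def sgn_if abs_if split: if_splits)
  have "conformal c u" using sgn by (simp add: conformal_def)
  moreover have "u $ e \<noteq> 0 \<longleftrightarrow> w $ e \<noteq> 0" for e
  proof (cases "c $ e = 0")
    case False
    then show ?thesis using sgn[OF False] assms(3) by (auto simp: supp_def sgn_zero_iff)
  qed (simp add: u_def)
  then have "supp u = supp w" by (simp add: supp_def)
  moreover have "u \<in> flow_space G" unfolding u_def
    using assms by (intro subspace_add subspace_scale subspace_flow_space)
  ultimately show ?thesis by blast
qed

section \<open>The classes attached to edges and circuits\<close>

lemma edge_class_eq:
  fixes G :: "('v, 'e::finite) pre_digraph"
  assumes G: "fin_digraph G"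
  shows "edge_class G e = zono_face (flow_space G) ` {w \<in> flow_space G. supp w = arcs G - {e}}"
proof -
  have "edge_class G e = Amini_inv G ` {A \<in> strongly_oriented_subgraphs G. fst A = arcs G - {e}}"
    by (force simp: edge_class_def)
  also have "{A \<in> strongly_oriented_subgraphs G. fst A = arcs G - {e}} =
      sign_pattern ` {w \<in> flow_space G. supp w = arcs G - {e}}"
    unfolding strongly_oriented_subgraphs_eq[OF G] Compr_image_eq by simp
  finally show ?thesis by (simp add: image_image Amini_inv_sign_pattern[OF G])
qed

lemma circuit_class_eq:
  fixes G :: "('v, 'e::finite) pre_digraph"
  assumes G: "fin_digraph G"
  shows "circuit_class G H = zono_face (flow_space G) `
    {w \<in> flow_space G. sign_pattern w \<in> oriented_circuits G \<and> supp w = H}" (is "_ = zono_face ?W ` ?Q")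
proof -
  \<comment> \<open>\<open>opposite C\<close> is again an oriented circuit on \<open>H\<close>, so
    the union of the pairs is the set of faces of all orientations of \<open>H\<close>.\<close>
  have "circuit_class G H = circuit_face G ` {C \<in> oriented_circuits G. fst C = H}"
    using opposite_oriented_circuit[OF G] by (auto simp: circuit_class_def)
  also have "{C \<in> oriented_circuits G. fst C = H} = sign_pattern ` ?Q"
  proof (intro equalityI subsetI)
    fix C assume "C \<in> {C \<in> oriented_circuits G. fst C = H}"
    then show "C \<in> sign_pattern ` ?Q"
      using sign_pattern_circuit_element[OF G] circuit_element_flow_space[OF G] supp_circuit_element[OF G]
      by (intro image_eqI[of _ _ "circuit_element C"]) auto
  qed auto
  also have "circuit_face G ` sign_pattern ` ?Q = zono_face ?W ` ?Q"
    unfolding image_image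
  proof (intro image_cong refl)
    fix w assume w: "w \<in> ?Q"
    then have C: "sign_pattern w \<in> oriented_circuits G" by simp
    show "circuit_face G (sign_pattern w) = zono_face ?W w"
      unfolding circuit_face_eq[OF G C]
      using zono_face_eq_iff[OF subspace_flow_space circuit_element_flow_space[OF G C], of w]
        sign_pattern_circuit_element[OF G C] w by simp
  qed
  finally show ?thesis .
qed

theorem theorem3p7:
  fixes G :: "('v, 'e::finite) pre_digraph"
  assumes "fin_digraph G"
    and "three_connected G"
  shows "bij_betw (edge_class G) (arcs G) (parallel_classes (voronoi_edges G))
    \<and> bij_betw (circuit_class G) (circuits G) (parallel_classes (voronoi_facets G))
    \<and> (\<forall>e\<in>arcs G. \<forall>C\<in>oriented_circuits G.
          (e \<in> fst C \<longleftrightarrow> (\<forall>F\<in>edge_class G e. \<not> F \<subseteq> circuit_face G C)) \<and>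
          (e \<in> fst C \<longrightarrow> (\<forall>F\<in>edge_class G e. \<not> F \<subseteq> circuit_face G (opposite C))))"
proof (intro conjI ballI)
  note G = assms(1) and tc = assms(2)
  let ?W = "flow_space G"
  note W = subspace_flow_space[of G]
  have faces: "F face_of voronoi_cell G \<and> F \<noteq> {} \<longleftrightarrow> F \<in> zono_face ?W ` ?W" for F
    using voronoi_faces_eq[OF G] unfolding voronoi_faces_def by blast

  show "bij_betw (edge_class G) (arcs G) (parallel_classes (voronoi_edges G))"
  proof -
    \<comment> \<open>The flows exposing edges; grouped by support they give one class for each
      deleted arc.\<close>
    define Q where "Q = {w \<in> ?W. \<exists>e\<in>arcs G. supp w = arcs G - {e}}"
    have "voronoi_edges G = {F. (F face_of voronoi_cell G \<and> F \<noteq> {}) \<and> aff_dim F = 1}"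
      by (auto simp: voronoi_edges_def edge_of_def)
    also have "\<dots> = zono_face ?W ` Q"
      unfolding faces Q_def using aff_dim_zono_face_eq_1_iff[OF G tc] by blast
    finally have edges: "voronoi_edges G = zono_face ?W ` Q" .
    \<comment> \<open>The nowhere zero flows on \<open>arcs G - {e}\<close> show that each
      complement occurs as a support; distinct arcs have distinct complements.\<close>
    have "bij_betw (\<lambda>e. arcs G - {e}) (arcs G) (supp ` Q)"
    proof (rule bij_betwI')
      show "e \<in> arcs G \<Longrightarrow> arcs G - {e} \<in> supp ` Q" for e
        using three_connected_nowhere_zero_flow[OF G tc, of e] unfolding Q_def by force
    qed (auto simp: Q_def)
    from bij_betw_trans[OF this bij_betw_parallel_classes[OF W, of Q]]
    have "bij_betw (\<lambda>e. zono_face ?W ` {w \<in> Q. supp w = arcs G - {e}}) (arcs G)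
      (parallel_classes (voronoi_edges G))"
      by (simp add: edges Q_def comp_def)
    moreover have "edge_class G e = zono_face ?W ` {w \<in> Q. supp w = arcs G - {e}}" if "e \<in> arcs G" for e
      unfolding edge_class_eq[OF G] Q_def using that by (intro arg_cong[of _ _ "image _"]) blast
    ultimately show ?thesis by (simp cong: bij_betw_cong)
  qed

  show "bij_betw (circuit_class G) (circuits G) (parallel_classes (voronoi_facets G))"
  proof -
    define Q where "Q = {w \<in> ?W. sign_pattern w \<in> oriented_circuits G}"
    \<comment> \<open>The codimension of a face is the dimension of the flows within the support,
      and this is one exactly for circuits.\<close>
    have codim: "aff_dim (zono_face ?W w) = aff_dim (voronoi_cell G) - 1 \<longleftrightarrow>
      sign_pattern w \<in> oriented_circuits G" if "w \<in> ?W" for w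
      using dim_restrict_support_eq_1_iff[OF G that]
      by (auto simp: voronoi_cell_eq_zonotope[OF G] aff_dim_zonotope[OF W] aff_dim_zono_face[OF W that])
    have "voronoi_facets G = {F. (F face_of voronoi_cell G \<and> F \<noteq> {}) \<and>
        aff_dim F = aff_dim (voronoi_cell G) - 1}"
      by (auto simp: voronoi_facets_def facet_of_def)
    also have "\<dots> = zono_face ?W ` Q"
      unfolding faces Q_def using codim by blast
    finally have facets: "voronoi_facets G = zono_face ?W ` Q" .
    have "supp ` Q = circuits G"
    proof
      show "supp ` Q \<subseteq> circuits G"
        unfolding Q_def circuits_def by (auto intro!: rev_image_eqI)
      show "circuits G \<subseteq> supp ` Q"
      proof
        fix H assume "H \<in> circuits G"
        then obtain C where C: "C \<in> oriented_circuits G" "H = fst C" by (auto simp: circuits_def)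
        then have "circuit_element C \<in> Q" "supp (circuit_element C) = H"
          using circuit_element_flow_space[OF G] sign_pattern_circuit_element[OF G]
            supp_circuit_element[OF G] by (auto simp: Q_def)
        then show "H \<in> supp ` Q" by blast
      qed
    qed
    moreover have "circuit_class G = (\<lambda>H. zono_face ?W ` {w \<in> Q. supp w = H})"
      unfolding circuit_class_eq[OF G] Q_def by (intro ext arg_cong[of _ _ "image _"]) blast
    moreover have "Q \<subseteq> ?W" by (auto simp: Q_def)
    ultimately show ?thesis
      using bij_betw_parallel_classes[OF W, of Q] by (simp add: facets)
  qed

  fix e C assume e: "e \<in> arcs G" and C: "C \<in> oriented_circuits G"
  have sub: "zono_face ?W w \<subseteq> circuit_face G C' \<longleftrightarrow> conformal (circuit_element C') w"
    if "w \<in> ?W" "C' \<in> oriented_circuits G" for w C'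
    using that by (simp add: circuit_face_eq[OF G] zono_face_subset_iff[OF W] circuit_element_flow_space[OF G])
  \<comment> \<open>A flow whose face lies in \<open>circuit_face G C'\<close> has the signs of
    \<open>C'\<close> and so uses \<open>e\<close>, whereas the class of \<open>e\<close> comes from
    flows avoiding \<open>e\<close>. This serves for \<open>C\<close> and for
    \<open>opposite C\<close>.\<close>
  have avoid: "\<not> F \<subseteq> circuit_face G C'"
    if "C' \<in> oriented_circuits G" "e \<in> fst C'" "F \<in> edge_class G e" for C' F
  proof
    assume F: "F \<subseteq> circuit_face G C'"
    obtain w where w: "w \<in> ?W" "supp w = arcs G - {e}" "F = zono_face ?W w"
      using \<open>F \<in> edge_class G e\<close> by (auto simp: edge_class_eq[OF G])
    then have "conformal (circuit_element C') w" using F sub that(1) by simp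
    moreover have "circuit_element C' $ e \<noteq> 0"
      using supp_circuit_element[OF G that(1)] that(2) by (auto simp: supp_def)
    ultimately have "e \<in> supp w" by (auto simp: conformal_def supp_def sgn_zero_iff)
    then show False using w(2) by simp
  qed
  show "e \<in> fst C \<longleftrightarrow> (\<forall>F\<in>edge_class G e. \<not> F \<subseteq> circuit_face G C)"
  proof
    assume none: "\<forall>F\<in>edge_class G e. \<not> F \<subseteq> circuit_face G C"
    show "e \<in> fst C"
    proof (rule ccontr)
      \<comment> \<open>The signs of \<open>C\<close> then extend to a flow with support
        \<open>arcs G - {e}\<close>; its face belongs to the class and lies in
        \<open>circuit_face G C\<close>.\<close>
      assume "e \<notin> fst C"
      obtain w where w: "w \<in> ?W" "supp w = arcs G - {e}"
        using three_connected_nowhere_zero_flow[OF G tc e] by blast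
      have c: "circuit_element C \<in> ?W" by (rule circuit_element_flow_space[OF G C])
      then have "supp (circuit_element C) \<subseteq> supp w"
        using \<open>e \<notin> fst C\<close> w(2) supp_circuit_element[OF G C] by (auto simp: flow_space_def)
      then obtain u where "u \<in> ?W" "supp u = arcs G - {e}" "conformal (circuit_element C) u"
        using conformal_extension[OF c w(1)] w(2) by auto
      then show False using none sub[OF _ C] by (auto simp: edge_class_eq[OF G])
    qed
  qed (use avoid[OF C] in blast)
  show "e \<in> fst C \<longrightarrow> (\<forall>F\<in>edge_class G e. \<not> F \<subseteq> circuit_face G (opposite C))"
    using avoid[OF opposite_oriented_circuit[OF G C]] by auto
qed

end
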